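(* Let $M,N$ be positive integers varying so that $M+N\to\infty$, and assume $\lim_{M+N\to\infty} M/N=\infty$. Given $k\in\{1,\ldots,N\}$, let $\rho=2/\sqrt{N\psi'(N-k+1)}$, and for $\theta\in(-\pi,\pi]$ set $$z_j=e^{M\left(\frac12\psi(N-k+1)+\frac{v_j}{\rho\sqrt{MN}}\right)}\,e^{i(\theta+\phi_j)},\qquad j=1,\ldots,n.$$ Then the $n$-point correlation functions $R^{(n)}_{M,N}$ of the eigenvalues of $\Pi_M=X_M\cdots X_1$ (a product of i.i.d. $N\times N$ complex Ginibre matrices) satisfy $$\lim_{M+N\to\infty}\Big(\frac{\sqrt M}{\rho\sqrt N}\Big)^{n}\,|z_1\cdots z_n|^2\,R^{(n)}_{M,N}(z_1,\ldots,z_n)=\begin{cases}\dfrac{1}{(\sqrt{2\pi})^3}\,e^{-\frac12 v_1^2}, & n=1,\\[1ex] 0, & n>1,\end{cases}$$ uniformly for $v_1,\ldots,v_n$ in a compact subset of $\mathbb R$ and $\phi_1,\ldots,\phi_n\in(-\pi,\pi]$.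
   Context: $\psi(z)=\Gamma'(z)/\Gamma(z)$ is the digamma function and $\psi'$ its derivative; $n\ge1$ is a fixed integer. $N$ may stay bounded or tend to infinity, and $k$ may vary with $M,N$. Model: $X_1,\ldots,X_M$ are i.i.d. complex Ginibre matrices of size $N\times N$, i.e. each has i.i.d. standard complex Gaussian entries, and $\Pi_M=X_M\cdots X_1$. The eigenvalues of $\Pi_M$ form a determinantal point process in $\mathbb C$ (with respect to Lebesgue measure), with correlation functions $$R^{(n)}_{M,N}(z_1,\ldots,z_n)=\det[K_{M,N}(z_i,z_j)]_{i,j=1}^n,\qquad K_{M,N}(z_1,z_2)=\frac1\pi\sqrt{w(z_1)w(z_2)}\sum_{j=0}^{N-1}\frac{(z_1\overline{z}_2)^j}{\Gamma(j+1)^M},$$ where, for some $c>0$, $$w(z)=\int_{-c-i\infty}^{-c+i\infty}\frac{ds}{2\pi i}\,(\Gamma(-s))^M|z|^{2s}.$$ *)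

theory Defs
  imports "HOL-Probability.Probability" "Jordan_Normal_Form.Char_Poly"
begin

text \<open>
  A standard complex Gaussian has density \<open>exp (-\<bar>z\<bar>\<^sup>2) / \<pi>\<close> with respect to Lebesgue measure
  on the complex plane.
\<close>

definition std_complex_gaussian :: "'w measure \<Rightarrow> ('w \<Rightarrow> complex) \<Rightarrow> bool" where
  "std_complex_gaussian P Z \<longleftrightarrow>
     distributed P lborel Z (\<lambda>z. ennreal (exp (- (cmod z)\<^sup>2) / pi))"

text \<open>
  \<open>X 1, \<dots>, X M\<close> are independent complex Ginibre matrices of size \<open>N \<times> N\<close>: all
  entries of all the matrices are jointly independent standard complex Gaussians.
\<close>

definition ginibre_family ::
  "'w measure \<Rightarrow> nat \<Rightarrow> nat \<Rightarrow> (nat \<Rightarrow> 'w \<Rightarrow> complex mat) \<Rightarrow> bool" where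
  "ginibre_family P M N X \<longleftrightarrow>
     prob_space P \<and>
     (\<forall>i\<in>{1..M}. \<forall>\<omega>\<in>space P. X i \<omega> \<in> carrier_mat N N) \<and>
     (\<forall>i\<in>{1..M}. \<forall>a<N. \<forall>b<N. std_complex_gaussian P (\<lambda>\<omega>. X i \<omega> $$ (a, b))) \<and>
     prob_space.indep_vars P (\<lambda>_. borel) (\<lambda>(i, a, b) \<omega>. X i \<omega> $$ (a, b))
       ({1..M} \<times> {..<N} \<times> {..<N})"

text \<open>\<open>X M * \<dots> * X 1\<close>\<close>

primrec ginibre_product :: "nat \<Rightarrow> (nat \<Rightarrow> 'w \<Rightarrow> complex mat) \<Rightarrow> nat \<Rightarrow> 'w \<Rightarrow> complex mat" where
  "ginibre_product N X 0 \<omega> = 1\<^sub>m N"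
| "ginibre_product N X (Suc m) \<omega> = X (Suc m) \<omega> * ginibre_product N X m \<omega>"

text \<open>
  The eigenvalues with algebraic multiplicity, in an arbitrary order; the order is immaterial
  below.
\<close>

definition eigenvalue_list :: "complex mat \<Rightarrow> complex list" where
  "eigenvalue_list A = (SOME xs. mset xs = proots (char_poly A))"

text \<open>
  \<open>R\<close> is an \<open>n\<close>-point correlation function, with respect to Lebesgue measure, of the finite
  random point configuration \<open>pts\<close>: for all measurable \<open>f \<ge> 0\<close>, the expectation of the sum of \<open>f\<close>
  over all \<open>n\<close>-tuples of points with pairwise distinct indices is \<open>\<integral> f R\<close>.
  Points of \<open>\<complex>\<^sup>n\<close> are functions on \<open>{..<n}\<close>.
\<close>

definition is_correlation_function ::
  "'w measure \<Rightarrow> ('w \<Rightarrow> complex list) \<Rightarrow> nat \<Rightarrow> ((nat \<Rightarrow> complex) \<Rightarrow> real) \<Rightarrow> bool" where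
  "is_correlation_function P pts n R \<longleftrightarrow>
     R \<in> borel_measurable (\<Pi>\<^sub>M j\<in>{..<n}. lborel) \<and>
     (\<forall>z \<in> space (\<Pi>\<^sub>M j\<in>{..<n}. lborel). R z \<ge> 0) \<and>
     (\<forall>f \<in> borel_measurable (\<Pi>\<^sub>M j\<in>{..<n}. lborel).
        (\<integral>\<^sup>+ \<omega>. (\<Sum>\<sigma> | \<sigma> \<in> {..<n} \<rightarrow>\<^sub>E {..<length (pts \<omega>)} \<and> inj_on \<sigma> {..<n}.
                   f (\<lambda>j\<in>{..<n}. pts \<omega> ! \<sigma> j)) \<partial>P)
        = (\<integral>\<^sup>+ z. f z * ennreal (R z) \<partial>(\<Pi>\<^sub>M j\<in>{..<n}. lborel)))"

text \<open>The contour integral along \<open>s = -c + \<i>t\<close>, with \<open>ds = \<i> dt\<close>.\<close>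

definition ginibre_weight :: "real \<Rightarrow> nat \<Rightarrow> complex \<Rightarrow> complex" where
  "ginibre_weight c M z =
     (\<integral>t. (let s = Complex (- c) t
           in Gamma (- s) ^ M * complex_of_real (cmod z) powr (2 * s) * \<i> / (2 * pi * \<i>)) \<partial>lborel)"

definition ginibre_kernel :: "real \<Rightarrow> nat \<Rightarrow> nat \<Rightarrow> complex \<Rightarrow> complex \<Rightarrow> complex" where
  "ginibre_kernel c M N z1 z2 =
     1 / pi * csqrt (ginibre_weight c M z1 * ginibre_weight c M z2) *
       (\<Sum>j<N. (z1 * cnj z2) ^ j / Gamma (of_nat j + 1) ^ M)"

definition rho :: "nat \<Rightarrow> nat \<Rightarrow> real" where
  "rho N k = 2 / sqrt (real N * Polygamma 1 (real (N - k + 1)))"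

definition scaled_point :: "nat \<Rightarrow> nat \<Rightarrow> nat \<Rightarrow> real \<Rightarrow> real \<Rightarrow> real \<Rightarrow> complex" where
  "scaled_point M N k \<theta> v \<phi> =
     complex_of_real
       (exp (real M * (Digamma (real (N - k + 1)) / 2 + v / (rho N k * sqrt (real M * real N))))) *
     exp (\<i> * complex_of_real (\<theta> + \<phi>))"

end

theory Submission
  imports Defs "HOL-Complex_Analysis.Complex_Analysis" "HOL-Real_Asymp.Real_Asymp"
begin

text \<open>
  Write \<open>a = N - k\<close>, \<open>x = a + 1\<close> and \<open>S\<^sup>2 = M \<psi>'(x)\<close>. Shifting the contour of the weight to \<open>Re s = -x\<close>
  shows that the term \<open>j = a\<close> of the scaled kernel on the diagonal is, up to the factor \<open>1 / (2\<pi>)\<close>, the density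
  of the normalized sum of \<open>M\<close> independent copies of \<open>ln G\<close>, where \<open>G\<close> has the Gamma distribution with
  shape parameter \<open>x\<close>. A local central limit theorem that is uniform in \<open>x \<ge> 1\<close> gives the Gaussian limit of this
  term. It rests on the majorant \<open>1 / (1 + s\<^sup>2 / 2)\<close> of the characteristic functions. Relative to the term
  \<open>j = a\<close>, the term \<open>j\<close> is an explicit exponential, at most \<open>exp (- \<bar>j - a\<bar> T (T / 4 - O(1)))\<close> with
  \<open>T\<^sup>2 = M / x \<ge> M / N \<rightarrow> \<infinity>\<close>, so the other terms vanish. Hence the matrix of kernel values
  is, up to conjugation by a diagonal unitary matrix, asymptotically of rank one, and its determinant tends to
  zero for \<open>n > 1\<close>.
\<close>

section \<open>Bounds for the trigamma and tetragamma functions\<close>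

lemma trigamma_sums:
  fixes x :: real
  assumes "x > 0"
  shows "(\<lambda>k. inverse ((x + real k)\<^sup>2)) sums Polygamma 1 x"
  using Polygamma_LIMSEQ[of x 1] assms by (simp add: eval_nat_numeral)

text \<open>With \<open>y = x + k\<close>, the telescoping terms
  \<open>1 / y - 1 / (y + 1) = 1 / (y * (y + 1))\<close> lie below the terms of the trigamma series
  and sum to \<open>1 / x\<close>.\<close>

lemma trigamma_ge_inverse:
  fixes x :: real
  assumes "x > 0"
  shows "1 / x \<le> Polygamma 1 x"
proof -
  have "(\<lambda>k. inverse (x + real (Suc k)) - inverse (x + real k)) sums (0 - inverse (x + real 0))"
    by (intro telescope_sums filterlim_compose[OF tendsto_inverse_0]
              tendsto_add_filterlim_at_infinity[OF tendsto_const] tendsto_of_nat)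
  from sums_minus[OF this]
  have s: "(\<lambda>k. inverse (x + real k) - inverse (x + real (Suc k))) sums (1 / x)"
    by (simp add: inverse_eq_divide)
  show ?thesis
  proof (rule sums_le[OF _ s trigamma_sums[OF assms]])
    fix k
    define y where "y = x + real k"
    have y: "y > 0" using assms by (simp add: y_def)
    then have "inverse y - inverse (y + 1) = inverse (y * (y + 1))"
      by (simp add: field_simps)
    also have "\<dots> \<le> inverse (y\<^sup>2)"
      using y by (intro le_imp_inverse_le) (auto simp: power2_eq_square)
    finally show "inverse (x + real k) - inverse (x + real (Suc k)) \<le> inverse ((x + real k)\<^sup>2)"
      by (simp add: y_def add_ac)
  qed
qed

lemma trigamma_pos:
  fixes x :: real
  assumes "x > 0"
  shows "Polygamma 1 x > 0"
  using trigamma_ge_inverse[OF assms] assms by (smt (verit) divide_pos_pos)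

text \<open>Twice the same telescoping series is a majorant, because
  \<open>y * (y + 1) / 2 \<le> y\<^sup>2\<close> for \<open>y \<ge> 1\<close>.\<close>

lemma trigamma_le:
  fixes x :: real
  assumes "x \<ge> 1"
  shows "Polygamma 1 x \<le> 2 / x"
proof -
  have "(\<lambda>k. inverse (x + real (Suc k)) - inverse (x + real k)) sums (0 - inverse (x + real 0))"
    by (intro telescope_sums filterlim_compose[OF tendsto_inverse_0]
              tendsto_add_filterlim_at_infinity[OF tendsto_const] tendsto_of_nat)
  from sums_minus[OF this]
  have s: "(\<lambda>k. inverse (x + real k) - inverse (x + real (Suc k))) sums (1 / x)"
    by (simp add: inverse_eq_divide)
  show ?thesis
  proof (rule sums_le[OF _ trigamma_sums])
    show "(\<lambda>k. 2 * (inverse (x + real k) - inverse (x + real (Suc k)))) sums (2 / x)"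
      using sums_mult[OF s, of 2] by simp
    fix k
    define y where "y = x + real k"
    have y: "y \<ge> 1" using assms by (simp add: y_def)
    then have "inverse (y\<^sup>2) \<le> inverse (y * (y + 1) / 2)"
      by (intro le_imp_inverse_le) (auto simp: power2_eq_square)
    also have "\<dots> = 2 * (inverse y - inverse (y + 1))"
      using y by (simp add: field_simps)
    finally show "inverse ((x + real k)\<^sup>2) \<le> 2 * (inverse (x + real k) - inverse (x + real (Suc k)))"
      by (simp add: y_def add_ac)
  qed (use assms in simp)
qed

text \<open>One factor of each inverse cube is bounded by \<open>1 / x\<close>, which leaves the
  trigamma series at \<open>x\<close>. Being uniform on a half-plane, the bound controls a Taylor
  remainder of \<open>ln_Gamma\<close> along a vertical line.\<close>

lemma cmod_tetragamma_le:
  fixes z :: complex and x :: real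
  assumes "x \<ge> 1" and "Re z \<ge> x"
  shows "cmod (Polygamma 2 z) \<le> 4 / x\<^sup>2"
proof -
  have z0: "z \<noteq> 0" using assms by auto
  have le: "x + real k \<le> cmod (z + of_nat k)" for k
    using complex_Re_le_cmod[of "z + of_nat k"] assms by simp
  have t: "norm (inverse ((z + of_nat k) ^ 3)) \<le> 1 / x * inverse ((x + real k)\<^sup>2)" for k
  proof -
    have "x * (x + real k)\<^sup>2 \<le> (x + real k) ^ 3"
      using assms by (simp add: power3_eq_cube power2_eq_square algebra_simps)
    also have "\<dots> \<le> cmod (z + of_nat k) ^ 3"
      using le assms by (intro power_mono) auto
    finally have "inverse (cmod (z + of_nat k) ^ 3) \<le> inverse (x * (x + real k)\<^sup>2)"
      using assms by (intro le_imp_inverse_le) auto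
    then show ?thesis by (simp add: norm_inverse norm_power divide_inverse mult.commute)
  qed
  have s: "(\<lambda>k. 1 / x * inverse ((x + real k)\<^sup>2)) sums (1 / x * Polygamma 1 x)"
    using assms by (intro sums_mult trigamma_sums) simp
  have s': "(\<lambda>k. inverse ((z + of_nat k) ^ 3)) sums (- Polygamma 2 z / 2)"
    using Polygamma_LIMSEQ[OF z0, of 2] by (simp add: eval_nat_numeral)
  have "cmod (- Polygamma 2 z / 2) \<le> 1 / x * Polygamma 1 x"
    unfolding sums_unique[OF s'] sums_unique[OF s]
    by (rule norm_suminf_le[OF t sums_summable[OF s]])
  also have "\<dots> \<le> 1 / x * (2 / x)"
    using trigamma_le[OF assms(1)] assms by (intro mult_left_mono) auto
  finally show ?thesis by (simp add: power2_eq_square norm_divide)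
qed

section \<open>Decay of the Gamma function along vertical lines\<close>

lemma one_plus_sum_le_prod:
  fixes f :: "'a \<Rightarrow> real"
  assumes "\<And>i. i \<in> A \<Longrightarrow> f i \<ge> 0"
  shows "1 + sum f A \<le> (\<Prod>i\<in>A. 1 + f i)"
  using assms
proof (induction A rule: infinite_finite_induct)
  case (insert a A)
  have "1 + sum f (insert a A) \<le> (1 + f a) * (1 + sum f A)"
    using insert by (simp add: algebra_simps sum_nonneg)
  also have "\<dots> \<le> (1 + f a) * (\<Prod>i\<in>A. 1 + f i)"
    using insert by (intro mult_left_mono) auto
  finally show ?case using insert by simp
qed auto

text \<open>Only the terms of order \<open>t\<^sup>2\<close> in the Gauss product for \<open>\<bar>\<Gamma>(x) / \<Gamma>(x + \<i>t)\<bar>\<^sup>2\<close> are kept.\<close>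

lemma cmod_Gamma_square_le:
  fixes x t :: real
  assumes "x > 0"
  shows "(cmod (Gamma (Complex x t)))\<^sup>2 * (1 + t\<^sup>2 * Polygamma 1 x) \<le> (Gamma x)\<^sup>2"
proof (rule LIMSEQ_le)
  let ?z = "Complex x t"
  define h where "h = (\<lambda>m. \<Sum>k<m. inverse ((x + real k)\<^sup>2))"
  have "h \<longlonglongrightarrow> Polygamma 1 x"
    using trigamma_sums[OF assms] by (simp add: h_def sums_def)
  then have h1: "(\<lambda>m. h (Suc m)) \<longlonglongrightarrow> Polygamma 1 x" by (rule LIMSEQ_Suc)
  show "(\<lambda>m. (cmod (Gamma_series ?z m))\<^sup>2 * (1 + t\<^sup>2 * h (Suc m)))
      \<longlonglongrightarrow> (cmod (Gamma ?z))\<^sup>2 * (1 + t\<^sup>2 * Polygamma 1 x)"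
    by (intro tendsto_intros h1)
  show "(\<lambda>m. (Gamma_series x m)\<^sup>2) \<longlonglongrightarrow> (Gamma x)\<^sup>2" by (intro tendsto_intros)
  have "(cmod (Gamma_series ?z m))\<^sup>2 * (1 + t\<^sup>2 * h (Suc m)) \<le> (Gamma_series x m)\<^sup>2" if "m \<ge> 1" for m
  proof -
    \<comment> \<open>The numerators of both Gamma series have modulus \<open>c\<close>, so only the
      Pochhammer products have to be compared.\<close>
    define c where "c = fact m * exp (x * ln (real m))"
    have c: "c > 0" by (simp add: c_def)
    define p where "p = (\<Prod>k<Suc m. (x + real k)\<^sup>2)"
    have p: "p > 0" using assms by (auto simp: p_def simp del: prod.lessThan_Suc intro!: prod_pos)
    define q where "q = (\<Prod>k<Suc m. 1 + t\<^sup>2 * inverse ((x + real k)\<^sup>2))"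
    have eq: "(x + real k)\<^sup>2 + t\<^sup>2 = (x + real k)\<^sup>2 * (1 + t\<^sup>2 * inverse ((x + real k)\<^sup>2))" for k
    proof -
      have "(x + real k)\<^sup>2 \<noteq> 0" using assms by simp
      then show ?thesis by (simp add: field_simps)
    qed
    have "(cmod (pochhammer ?z (m + 1)))\<^sup>2 = (\<Prod>k<Suc m. (cmod (?z + of_nat k))\<^sup>2)"
      by (simp add: pochhammer_prod atLeast0LessThan prod_norm[symmetric] prod_power_distrib
               del: prod.lessThan_Suc)
    also have "\<dots> = (\<Prod>k<Suc m. (x + real k)\<^sup>2 + t\<^sup>2)"
      by (intro prod.cong refl) (simp add: cmod_power2)
    also have "\<dots> = p * q"
      unfolding p_def q_def prod.distrib[symmetric] using eq by simp
    finally have P: "(cmod (pochhammer ?z (m + 1)))\<^sup>2 = p * q" .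
    have "cmod (exp (?z * of_real (ln (real m)))) = exp (x * ln (real m))" by simp
    then have G: "(cmod (Gamma_series ?z m))\<^sup>2 = c\<^sup>2 / (p * q)"
      unfolding Gamma_series_def norm_divide power_divide P
      by (simp add: norm_mult c_def power_mult_distrib)
    have "(pochhammer x (m + 1))\<^sup>2 = p"
      by (simp add: pochhammer_prod atLeast0LessThan prod_power_distrib p_def
               del: prod.lessThan_Suc)
    then have G': "(Gamma_series x m)\<^sup>2 = c\<^sup>2 / p"
      unfolding Gamma_series_def power_divide by (simp add: c_def)
    have Q: "1 + t\<^sup>2 * h (Suc m) \<le> q"
      unfolding q_def h_def sum_distrib_left
      by (intro one_plus_sum_le_prod) auto
    have q: "q \<ge> 1" unfolding q_def by (intro prod_ge_1) auto
    have "c\<^sup>2 / (p * q) * (1 + t\<^sup>2 * h (Suc m)) \<le> c\<^sup>2 / (p * q) * q"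
      using Q p q by (intro mult_left_mono) auto
    also have "\<dots> = c\<^sup>2 / p" using q by simp
    finally show ?thesis by (simp add: G G')
  qed
  then show "\<exists>M. \<forall>m\<ge>M. (cmod (Gamma_series ?z m))\<^sup>2 * (1 + t\<^sup>2 * h (Suc m)) \<le> (Gamma_series x m)\<^sup>2"
    by blast
qed

text \<open>\<open>(1 + s\<^sup>2 / M)\<^bsup>M\<^esup>\<close> increases with \<open>M\<close>, which gives a majorant that does not depend on \<open>M\<close>.\<close>

lemma cmod_Gamma_power_le:
  fixes x t :: real
  assumes "x > 0" "M \<ge> 2"
  shows "cmod (Gamma (Complex x t)) ^ M \<le> Gamma x ^ M / (1 + M * t\<^sup>2 * Polygamma 1 x / 2)"
proof -
  define y where "y = t\<^sup>2 * Polygamma 1 x"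
  define r where "r = cmod (Gamma (Complex x t)) / Gamma x"
  have G: "Gamma x > 0" using assms by simp
  have y: "y \<ge> 0" using trigamma_pos[OF assms(1)] by (simp add: y_def)
  have r0: "r \<ge> 0" using G by (simp add: r_def)
  have r: "r\<^sup>2 * (1 + y) \<le> 1"
    using cmod_Gamma_square_le[OF assms(1), of t] G
    by (simp add: r_def y_def power_divide divide_simps)
  have "(r ^ M * (1 + M * y / 2))\<^sup>2 \<le> 1\<^sup>2"
  proof -
    \<comment> \<open>The induction starts at \<open>M = 2\<close>, where both sides agree; this is
      where the constant \<open>1 / 2\<close> comes from.\<close>
    have "(1 + real M * y / 2)\<^sup>2 \<le> (1 + y) ^ M"
    proof -
      obtain m where m: "M = Suc (Suc m)" using assms(2) by (metis Suc_1 Suc_le_D numeral_2_eq_2 Suc_le_mono)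
      have "(1 + real (Suc (Suc m)) * y / 2)\<^sup>2 \<le> (1 + y) ^ Suc (Suc m)"
      proof (induction m)
        case 0
        then show ?case by (simp add: power2_eq_square)
      next
        case (Suc m)
        define b where "b = real (Suc (Suc m)) * y / 2"
        have "y * y \<le> y * b" using y by (intro mult_left_mono) (auto simp: b_def algebra_simps)
        moreover have "0 \<le> y * b\<^sup>2" "0 \<le> y * y" using y by auto
        moreover have "(1 + b)\<^sup>2 * (1 + y) - (1 + (b + y / 2))\<^sup>2 = y * b + y * b\<^sup>2 - y * y / 4"
          by (simp add: power2_eq_square field_simps)
        ultimately have "(1 + (b + y / 2))\<^sup>2 \<le> (1 + b)\<^sup>2 * (1 + y)" by linarith
        moreover have "real (Suc (Suc (Suc m))) * y / 2 = b + y / 2"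
          by (simp add: b_def algebra_simps add_divide_distrib)
        ultimately have "(1 + real (Suc (Suc (Suc m))) * y / 2)\<^sup>2 \<le> (1 + b)\<^sup>2 * (1 + y)"
          by (simp only:)
        also have "\<dots> \<le> (1 + y) ^ Suc (Suc m) * (1 + y)"
          using Suc y unfolding b_def by (intro mult_right_mono) auto
        finally show ?case by (simp add: mult_ac)
      qed
      then show ?thesis using m by simp
    qed
    then have "(r ^ M * (1 + M * y / 2))\<^sup>2 \<le> (r ^ M)\<^sup>2 * (1 + y) ^ M"
      by (simp add: power_mult_distrib mult_left_mono)
    also have "\<dots> = (r\<^sup>2 * (1 + y)) ^ M"
      by (simp add: power_mult_distrib power_mult[symmetric] mult.commute)
    also have "\<dots> \<le> 1" using r r0 y by (intro power_le_one) auto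
    finally show ?thesis by simp
  qed
  then have "r ^ M * (1 + M * y / 2) \<le> 1"
    by (rule power2_le_imp_le) simp
  then have "r ^ M \<le> 1 / (1 + M * y / 2)"
    using y by (simp add: pos_le_divide_eq add_pos_nonneg)
  then have "Gamma x ^ M * r ^ M \<le> Gamma x ^ M * (1 / (1 + M * y / 2))"
    using G by (intro mult_left_mono) auto
  moreover have "cmod (Gamma (Complex x t)) ^ M = Gamma x ^ M * r ^ M"
    using G by (simp add: r_def power_divide)
  ultimately show ?thesis by (simp add: y_def mult_ac)
qed

section \<open>The weight as a Mellin-Barnes integral and the shift of its contour\<close>

text \<open>This is the integrand of the weight at \<open>- s = Complex x t\<close>, where
  \<open>u\<close> stands for the logarithm of the squared modulus of the point.\<close>

definition mellin_line :: "nat \<Rightarrow> real \<Rightarrow> real \<Rightarrow> real \<Rightarrow> complex" where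
  "mellin_line M u x t = Gamma (Complex x t) ^ M * exp (- (Complex x t * of_real u))"

lemma Complex_eq_of_real: "Complex x t = of_real x + of_real t * \<i>"
  by (simp add: complex_eq_iff)

lemma continuous_on_mellin_line:
  assumes "x > 0"
  shows "continuous_on A (mellin_line M u x)"
proof -
  have "of_real x + of_real t * \<i> \<notin> \<int>\<^sub>\<le>\<^sub>0" for t :: real
    using assms by (auto elim!: nonpos_Ints_cases simp: complex_eq_iff)
  then show ?thesis
    unfolding mellin_line_def Complex_eq_of_real
    by (intro continuous_intros continuous_on_compose2[OF continuous_on_Gamma[of "- \<int>\<^sub>\<le>\<^sub>0"]]) auto
qed

lemma cmod_mellin_line_le:
  fixes x t :: real
  assumes "x > 0" "M \<ge> 2"
  shows "cmod (mellin_line M u x t) \<le> Gamma x ^ M * exp (- (x * u)) / (1 + M * t\<^sup>2 * Polygamma 1 x / 2)"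
  using mult_right_mono[OF cmod_Gamma_power_le[OF assms, of t], of "exp (- (x * u))"]
  by (simp add: mellin_line_def norm_mult norm_power)

lemma integrable_inverse_one_plus_square:
  fixes a :: real
  assumes "a > 0"
  shows "integrable lborel (\<lambda>t. 1 / (1 + a * t\<^sup>2))"
proof -
  have "set_integrable lborel (einterval (-\<infinity>) \<infinity>) (\<lambda>x. inverse (1 + x\<^sup>2))"
    by (rule integrable_inverse_1_plus_square)
  then have i: "integrable lborel (\<lambda>x::real. inverse (1 + x\<^sup>2))"
    by (simp add: set_integrable_def)
  show ?thesis
    using lborel_integrable_real_affine[OF i, of "sqrt a" 0] assms
    by (simp add: power_mult_distrib inverse_eq_divide)
qed

lemma integrable_mellin_line:
  assumes "x > 0" "M \<ge> 2"
  shows "integrable lborel (mellin_line M u x)"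
proof (rule Bochner_Integration.integrable_bound)
  show "integrable lborel (\<lambda>t::real. Gamma x ^ M * exp (- (x * u)) * (1 / (1 + (M * Polygamma 1 x / 2) * t\<^sup>2)))"
    using trigamma_pos[OF assms(1)] assms(2)
    by (intro integrable_mult_right integrable_inverse_one_plus_square) auto
  show "mellin_line M u x \<in> borel_measurable lborel"
    using borel_measurable_continuous_onI[OF continuous_on_mellin_line[OF assms(1), of UNIV M u]] by simp
  show "AE t in lborel. norm (mellin_line M u x t)
      \<le> norm (Gamma x ^ M * exp (- (x * u)) * (1 / (1 + (M * Polygamma 1 x / 2) * t\<^sup>2)))"
  proof (rule AE_I2)
    fix t :: real
    have "0 \<le> 1 + M * t\<^sup>2 * Polygamma 1 x / 2"
      using trigamma_pos[OF assms(1)] by (intro add_nonneg_nonneg) auto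
    then show "norm (mellin_line M u x t)
      \<le> norm (Gamma x ^ M * exp (- (x * u)) * (1 / (1 + (M * Polygamma 1 x / 2) * t\<^sup>2)))"
      using cmod_mellin_line_le[OF assms, of u t] assms
      by (simp add: norm_mult norm_divide mult_ac)
  qed
qed

text \<open>Dominated convergence. It reduces the contour shift to truncated lines, on which a
  primitive can be evaluated at the end points.\<close>

lemma LBINT_symmetric_tendsto:
  fixes f :: "real \<Rightarrow> complex"
  assumes "integrable lborel f"
  shows "(\<lambda>m. \<integral>t. indicator {- real m..real m} t *\<^sub>R f t \<partial>lborel) \<longlonglongrightarrow> (\<integral>t. f t \<partial>lborel)"
proof (rule integral_dominated_convergence[where w = "\<lambda>t. norm (f t)"])
  show "AE t in lborel. (\<lambda>m. indicator {- real m..real m} t *\<^sub>R f t) \<longlonglongrightarrow> f t"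
  proof (rule AE_I2)
    fix t :: real
    obtain m0 :: nat where "\<bar>t\<bar> \<le> real m0" using real_arch_simple by blast
    then have "eventually (\<lambda>m. indicator {- real m..real m} t *\<^sub>R f t = f t) sequentially"
      by (intro eventually_sequentiallyI[of m0]) (auto simp: indicator_def)
    then show "(\<lambda>m. indicator {- real m..real m} t *\<^sub>R f t) \<longlonglongrightarrow> f t"
      by (rule tendsto_eventually)
  qed
qed (use assms in \<open>auto simp: indicator_def intro!: borel_measurable_integrable\<close>)

text \<open>
  A primitive \<open>F\<close> of the integrand on the right half-plane reduces the contour shift to the decay of
  \<open>F (c + \<i>t) - F (x + \<i>t)\<close>, that is, of the integrand on a horizontal segment.
\<close>

lemma integral_mellin_line_shift:
  assumes "c > 0" "x > 0" "M \<ge> 2"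
  shows "(\<integral>t. mellin_line M u c t \<partial>lborel) = (\<integral>t. mellin_line M u x t \<partial>lborel)"
proof -
  define H where "H = {z. Re z > 0}"
  define f where "f = (\<lambda>z::complex. Gamma z ^ M * exp (- (z * of_real u)))"
  have H: "z \<notin> \<int>\<^sub>\<le>\<^sub>0" if "z \<in> H" for z
    using that by (auto elim!: nonpos_Ints_cases simp: H_def)
  have "convex H" "open H"
    by (auto simp: H_def convex_halfspace_Re_gt open_halfspace_Re_gt)
  moreover have "f holomorphic_on H"
    unfolding f_def using H by (intro holomorphic_intros) auto
  ultimately obtain F where F: "\<And>z. z \<in> H \<Longrightarrow> (F has_field_derivative f z) (at z within H)"
    by (rule holomorphic_convex_primitive') blast
  have F': "(F has_field_derivative f z) (at z)" if "z \<in> H" for z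
    using F[OF that] that \<open>open H\<close> at_within_open by metis
  have mf: "mellin_line M u y t = f (Complex y t)" for y t
    by (simp add: mellin_line_def f_def)
  define D where "D = (\<lambda>T. F (Complex c T) - F (Complex x T))"
  have FTC: "(\<integral>t. indicator {- real m..real m} t *\<^sub>R mellin_line M u y t \<partial>lborel)
      = (F (Complex y (real m)) - F (Complex y (- real m))) / \<i>" if "y > 0" for y m
  proof -
    have "((\<lambda>t. F (Complex y t) / \<i>) has_vector_derivative mellin_line M u y t)
        (at t within {- real m..real m})" for t
    proof -
      have "((\<lambda>t. Complex y t) has_vector_derivative \<i>) (at t within {- real m..real m})"
        unfolding Complex_eq_of_real by (auto intro!: derivative_eq_intros)
      moreover have "(F has_field_derivative f (Complex y t)) (at (Complex y t) within X)" for X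
        using F'[of "Complex y t"] that
        by (simp add: H_def has_field_derivative_at_within)
      ultimately have "(F \<circ> (\<lambda>t. Complex y t) has_vector_derivative (\<i> * f (Complex y t)))
          (at t within {- real m..real m})"
        by (rule field_vector_diff_chain_within)
      from has_vector_derivative_mult_left[OF this, of "- \<i>"]
      show ?thesis by (simp add: o_def mf field_simps)
    qed
    from integral_FTC_atLeastAtMost[of "- real m" "real m", OF _ this continuous_on_mellin_line[OF that]]
    show ?thesis by (simp add: algebra_simps)
  qed
  \<comment> \<open>The contour may move in either direction, so the end points are ordered
    first.\<close>
  define c1 c2 where "c1 = min c x" and "c2 = max c x"
  have c12: "0 < c1" "c1 \<le> c2" "c1 \<le> c" "c \<le> c2" "c1 \<le> x" "x \<le> c2"
    using assms by (auto simp: c1_def c2_def)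
  have "continuous_on {c1..c2} (\<lambda>y. Gamma y ^ M * exp (- (y * u)))"
    using c12 by (intro continuous_intros) (auto elim!: nonpos_Ints_cases)
  from compact_continuous_image[OF this compact_Icc]
  have "bounded ((\<lambda>y. Gamma y ^ M * exp (- (y * u))) ` {c1..c2})" by (rule compact_imp_bounded)
  then obtain K where K: "K > 0" "\<And>y. y \<in> {c1..c2} \<Longrightarrow> \<bar>Gamma y ^ M * exp (- (y * u))\<bar> \<le> K"
    unfolding bounded_pos by auto
  \<comment> \<open>\<open>K\<close> bounds the integrand on the real segment. The decay in
    \<open>T\<close> comes from the majorant, whose trigamma factor is at least
    \<open>1 / c2\<close> on the whole segment.\<close>
  have Dle: "cmod (D T) \<le> K * (1 / (1 + T\<^sup>2 / c2)) * \<bar>c - x\<bar>" for T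
  proof -
    define S where "S = closed_segment (Complex c T) (Complex x T)"
    have S: "Im z = T \<and> Re z \<in> {c1..c2}" if "z \<in> S" for z
    proof -
      obtain l where l: "0 \<le> l" "l \<le> 1" "z = (1 - l) *\<^sub>R Complex c T + l *\<^sub>R Complex x T"
        using \<open>z \<in> S\<close> by (auto simp: S_def in_segment)
      have "Re z = (1 - l) * c + l * x" "Im z = T" unfolding l(3) by (simp_all add: left_diff_distrib)
      moreover have "(1 - l) * c + l * x \<ge> (1 - l) * c1 + l * c1" "(1 - l) * c + l * x \<le> (1 - l) * c2 + l * c2"
        using l c12 by (intro add_mono mult_left_mono; simp)+
      ultimately show ?thesis by (simp add: algebra_simps)
    qed
    have SH: "S \<subseteq> H" using S c12 by (fastforce simp: H_def)
    have "cmod (F (Complex c T) - F (Complex x T)) \<le> K * (1 / (1 + T\<^sup>2 / c2)) * cmod (Complex c T - Complex x T)"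
    proof (rule field_differentiable_bound[where S = S and f' = f])
      show "convex S" by (simp add: S_def)
      show "(F has_field_derivative f z) (at z within S)" if "z \<in> S" for z
        using F'[of z] that SH has_field_derivative_at_within by blast
      show "cmod (f z) \<le> K * (1 / (1 + T\<^sup>2 / c2))" if "z \<in> S" for z
      proof -
        define y where "y = Re z"
        have z: "z = Complex y T" and y: "y \<in> {c1..c2}" "y > 0"
          using S[OF that] c12 by (auto simp: y_def complex_eq_iff)
        have "1 / c2 \<le> Polygamma 1 y"
          using trigamma_ge_inverse[OF y(2)] y c12 by (smt (verit) atLeastAtMost_iff frac_le)
        then have "1 / c2 \<le> real M / 2 * Polygamma 1 y"
          using mult_mono[of 1 "real M / 2" "1 / c2" "Polygamma 1 y"] assms c12 by auto
        from mult_left_mono[OF this, of "T\<^sup>2"]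
        have "1 + T\<^sup>2 / c2 \<le> 1 + M * T\<^sup>2 * Polygamma 1 y / 2" by (simp add: mult_ac)
        moreover have pos: "0 < 1 + T\<^sup>2 / c2" using c12 by (intro add_pos_nonneg) auto
        ultimately have d: "1 / (1 + M * T\<^sup>2 * Polygamma 1 y / 2) \<le> 1 / (1 + T\<^sup>2 / c2)"
          by (intro frac_le) auto
        have "Gamma y ^ M * exp (- (y * u)) \<le> K"
          using K(2)[OF y(1)] by linarith
        from mult_mono[OF this d] have "Gamma y ^ M * exp (- (y * u)) * (1 / (1 + M * T\<^sup>2 * Polygamma 1 y / 2))
            \<le> K * (1 / (1 + T\<^sup>2 / c2))"
          using K(1) y(2) trigamma_pos[OF y(2)]
          by (auto intro!: divide_nonneg_nonneg add_nonneg_nonneg simp del: One_nat_def)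
        then show ?thesis
          using cmod_mellin_line_le[OF y(2) assms(3), of u T] by (simp add: mf z)
      qed
    qed (auto simp: S_def)
    moreover have "Complex c T - Complex x T = of_real (c - x)" by (simp add: complex_eq_iff)
    ultimately show ?thesis by (simp add: D_def del: of_real_diff)
  qed
  have "(\<lambda>m. K * (1 / (1 + (real m)\<^sup>2 / c2)) * \<bar>c - x\<bar>) \<longlonglongrightarrow> 0"
    using c12 by real_asymp
  note lim0 = this
  have D0: "(\<lambda>m. D (real m)) \<longlonglongrightarrow> 0" "(\<lambda>m. D (- real m)) \<longlonglongrightarrow> 0"
    using Lim_null_comparison[OF always_eventually lim0, of "\<lambda>m. D (real m)"]
      Lim_null_comparison[OF always_eventually lim0, of "\<lambda>m. D (- real m)"]
      Dle[of "real m" for m] Dle[of "- real m" for m] by auto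
  define J where "J = (\<lambda>y m. \<integral>t. indicator {- real m..real m} t *\<^sub>R mellin_line M u y t \<partial>lborel)"
  have "(\<lambda>m. (D (real m) - D (- real m)) / \<i>) \<longlonglongrightarrow> (0 - 0) / \<i>"
    by (intro tendsto_intros D0) auto
  \<comment> \<open>By \<open>FTC\<close>, the truncated integrals along the two lines differ only
    by the values of \<open>D\<close> at the two ends.\<close>
  moreover have "(\<lambda>m. (D (real m) - D (- real m)) / \<i>) = (\<lambda>m. J c m - J x m)"
    unfolding J_def D_def FTC[OF assms(1)] FTC[OF assms(2)] by (rule ext) (simp add: algebra_simps)
  ultimately have J0: "(\<lambda>m. J c m - J x m) \<longlonglongrightarrow> 0" by simp
  have "(\<lambda>m. J c m - J x m) \<longlonglongrightarrow> (\<integral>t. mellin_line M u c t \<partial>lborel) - (\<integral>t. mellin_line M u x t \<partial>lborel)"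
    unfolding J_def using assms by (intro tendsto_diff LBINT_symmetric_tendsto integrable_mellin_line)
  from LIMSEQ_unique[OF this J0] show ?thesis by simp
qed

text \<open>Here the abscissa \<open>c\<close> is exchanged for a freely chosen \<open>x\<close>,
  which later becomes the index of the dominant Gamma factor.\<close>

lemma ginibre_weight_eq_mellin:
  assumes "cmod z = exp (u / 2)" "c > 0" "x > 0" "M \<ge> 2"
  shows "ginibre_weight c M z = (\<integral>t. mellin_line M u x t \<partial>lborel) / (2 * pi)"
proof -
  \<comment> \<open>Since \<open>- s\<close> runs down its line, the variable is reflected; it is
    written in the shape that the affine change of variables expects.\<close>
  have "ginibre_weight c M z = (\<integral>t. mellin_line M u c (0 + (- 1) * t) / (2 * pi) \<partial>lborel)"
    unfolding ginibre_weight_def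
  proof (rule Bochner_Integration.integral_cong[OF refl])
    fix t
    define s where "s = Complex (- c) t"
    have ms: "- s = Complex c (- t)" by (simp add: s_def complex_eq_iff)
    have "complex_of_real (cmod z) powr (2 * s) = exp (s * of_real u)"
      using assms(1) by (simp add: powr_def Ln_of_real)
    then show "(let s = Complex (- c) t
           in Gamma (- s) ^ M * complex_of_real (cmod z) powr (2 * s) * \<i> / (2 * pi * \<i>))
      = mellin_line M u c (0 + (- 1) * t) / (2 * pi)"
      unfolding Let_def s_def[symmetric] mellin_line_def
      by (simp add: ms[symmetric])
  qed
  also have "\<dots> = (\<integral>t. mellin_line M u c (0 + (- 1) * t) \<partial>lborel) / (2 * pi)" by simp
  also have "(\<integral>t. mellin_line M u c (0 + (- 1) * t) \<partial>lborel) = (\<integral>t. mellin_line M u c t \<partial>lborel)"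
    using lborel_integral_real_affine[of "-1" "mellin_line M u c" 0] by simp
  finally show ?thesis by (simp add: integral_mellin_line_shift[OF assms(2-4)])
qed

section \<open>The weight as a density, and a local central limit theorem\<close>

text \<open>
  The characteristic function of \<open>ln G - \<psi>(x)\<close> for a Gamma-distributed \<open>G\<close> with shape parameter \<open>x\<close>.
\<close>

definition log_gamma_char :: "real \<Rightarrow> real \<Rightarrow> complex" where
  "log_gamma_char x t = Gamma (Complex x t) / of_real (Gamma x) * cis (- (t * Digamma x))"

definition log_gamma_scale :: "nat \<Rightarrow> real \<Rightarrow> real" where
  "log_gamma_scale M x = sqrt (M * Polygamma 1 x)"

text \<open>
  The density, by Fourier inversion, of the normalized sum of \<open>M\<close> independent copies of \<open>ln G - \<psi>(x)\<close>.
\<close>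

definition log_gamma_density :: "nat \<Rightarrow> real \<Rightarrow> real \<Rightarrow> complex" where
  "log_gamma_density M x v =
     (\<integral>s. log_gamma_char x (s / log_gamma_scale M x) ^ M * cis (- (v * s)) \<partial>lborel) / (2 * pi)"

lemma log_gamma_scale_pos:
  assumes "x > 0" "M \<ge> 1"
  shows "log_gamma_scale M x > 0"
  using trigamma_pos[OF assms(1)] assms(2) by (simp add: log_gamma_scale_def)

text \<open>For \<open>v = 0\<close> the line through \<open>x\<close> passes through a saddle
  point: the derivative of \<open>M * ln_Gamma z - z * u\<close> vanishes at \<open>z = x\<close>.
  Substituting \<open>t = s / S\<close> then produces the Fourier integral, and the linear phase
  \<open>M * Digamma x\<close> is absorbed into \<open>log_gamma_char\<close>.\<close>

lemma ginibre_weight_eq_density: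
  fixes x v :: real
  assumes "cmod z = exp (u / 2)" "c > 0" "x > 0" "M \<ge> 2"
    and u: "u = M * Digamma x + v * log_gamma_scale M x"
  shows "ginibre_weight c M z =
    of_real (Gamma x ^ M * exp (- (x * u)) / log_gamma_scale M x) * log_gamma_density M x v"
proof -
  define S where "S = log_gamma_scale M x"
  have S: "S > 0" using log_gamma_scale_pos[of x M] assms by (simp add: S_def)
  have G: "Gamma x > 0" using assms by simp
  have eq: "mellin_line M u x (0 + (1 / S) * s) = of_real (Gamma x ^ M * exp (- (x * u))) *
      (log_gamma_char x (s / S) ^ M * cis (- (v * s)))" for s
  proof -
    have "cis (- (s / S * Digamma x)) ^ M * cis (- (v * s)) = cis (- (s / S * u))"
    proof -
      have "M * - (s / S * Digamma x) + - (v * s) = - (s / S * u)"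
        using S by (simp add: u S_def[symmetric] field_simps)
      then show ?thesis unfolding Complex.DeMoivre cis_mult by (simp only:)
    qed
    moreover have "exp (- (Complex x (s / S) * of_real u)) = of_real (exp (- (x * u))) * cis (- (s / S * u))"
      by (simp add: exp_eq_polar)
    ultimately show ?thesis
      using G by (simp add: mellin_line_def log_gamma_char_def power_mult_distrib power_divide field_simps)
  qed
  have "(\<integral>t. mellin_line M u x t \<partial>lborel)
      = \<bar>1 / S\<bar> *\<^sub>R (\<integral>s. mellin_line M u x (0 + (1 / S) * s) \<partial>lborel)"
    by (rule lborel_integral_real_affine) (use S in simp)
  also have "\<dots> = of_real (Gamma x ^ M * exp (- (x * u)) / S) * (log_gamma_density M x v * (2 * pi))"
    unfolding eq using S by (simp add: log_gamma_density_def S_def[symmetric] scaleR_conv_of_real)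
  finally show ?thesis
    unfolding ginibre_weight_eq_mellin[OF assms(1-4)] by (simp add: S_def)
qed

text \<open>The scale is chosen so that the majorant depends on neither \<open>M\<close> nor
  \<open>x\<close>; it dominates the Fourier integrals for all parameters at once.\<close>

lemma cmod_log_gamma_char_power_le:
  assumes "x > 0" "M \<ge> 2"
  shows "cmod (log_gamma_char x (s / log_gamma_scale M x) ^ M) \<le> 1 / (1 + 1 / 2 * s\<^sup>2)"
proof -
  have p: "Polygamma 1 x > 0" using trigamma_pos assms by simp
  have G: "Gamma x > 0" using assms by simp
  have "M * (s / log_gamma_scale M x)\<^sup>2 * Polygamma 1 x = s\<^sup>2"
    using p assms by (simp add: log_gamma_scale_def power_divide)
  then have "cmod (Gamma (Complex x (s / log_gamma_scale M x))) ^ M \<le> Gamma x ^ M / (1 + s\<^sup>2 / 2)"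
    using cmod_Gamma_power_le[OF assms, of "s / log_gamma_scale M x"] by simp
  then show ?thesis
    using G by (simp add: log_gamma_char_def norm_mult norm_power norm_divide power_divide field_simps)
qed

text \<open>Second-order Taylor expansion of \<open>ln_Gamma\<close> at \<open>x\<close>: the
  constant and linear terms cancel against \<open>Gamma x\<close> and the \<open>cis\<close> factor,
  and the third derivative bounds the remainder. A logarithm \<open>L\<close> is provided because
  the \<open>M\<close>-th power only multiplies it by \<open>M\<close>.\<close>

lemma log_gamma_char_expansion:
  fixes x t :: real
  assumes "x \<ge> 1"
  obtains L where "log_gamma_char x t = exp L"
    and "cmod (L + of_real (Polygamma 1 x * t\<^sup>2 / 2)) \<le> 2 / x\<^sup>2 * \<bar>t\<bar> ^ 3"
proof -
  \<comment> \<open>The successive derivatives of \<open>ln_Gamma\<close>; the index of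
    \<open>Polygamma\<close> lags by one.\<close>
  define f where "f = (\<lambda>i::nat. if i = 0 then ln_Gamma else (Polygamma (i - 1) :: complex \<Rightarrow> complex))"
  define H where "H = {z. Re z \<ge> x}"
  define w where "w = complex_of_real x"
  define z where "z = Complex x t"
  have d: "z - w = \<i> * of_real t" by (simp add: z_def w_def complex_eq_iff)
  have "cmod (f 0 z - (\<Sum>i\<le>2. f i w * (z - w) ^ i / fact i)) \<le> 4 / x\<^sup>2 * cmod (z - w) ^ Suc 2 / fact 2"
  proof (rule complex_Taylor)
    show "convex H" by (simp add: H_def convex_halfspace_Re_ge)
    show "w \<in> H" "z \<in> H" by (simp_all add: H_def w_def z_def)
    show "cmod (f (Suc 2) y) \<le> 4 / x\<^sup>2" if "y \<in> H" for y
      using cmod_tetragamma_le[OF assms, of y] that by (simp add: f_def H_def numeral_2_eq_2)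
    fix i :: nat and y assume y: "y \<in> H" "i \<le> 2"
    have "y \<notin> \<real>\<^sub>\<le>\<^sub>0" "y \<notin> \<int>\<^sub>\<le>\<^sub>0"
      using y(1) assms by (auto elim!: nonpos_Reals_cases nonpos_Ints_cases simp: H_def)
    then show "(f i has_field_derivative f (Suc i) y) (at y within H)"
      using has_field_derivative_at_within[OF has_field_derivative_ln_Gamma_complex, of y H]
        has_field_derivative_Polygamma[of y "i - 1" H]
      by (cases i) (auto simp: f_def)
  qed
  moreover have "(\<Sum>i\<le>2. f i w * (z - w) ^ i / fact i)
      = of_real (ln_Gamma x) + \<i> * of_real (t * Digamma x) - of_real (Polygamma 1 x * t\<^sup>2 / 2)"
  proof -
    have "(\<Sum>i\<le>2. f i w * (z - w) ^ i / fact i) = f 0 w + f 1 w * (z - w) + f 2 w * (z - w)\<^sup>2 / 2"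
      by (simp add: eval_nat_numeral)
    moreover have "f 0 w = of_real (ln_Gamma x)"
      using assms by (simp add: f_def w_def ln_Gamma_complex_of_real)
    moreover have "f 1 w = of_real (Digamma x)" "f 2 w = of_real (Polygamma 1 x)"
      using assms by (simp_all add: f_def w_def Polygamma_of_real)
    ultimately show ?thesis by (simp add: d power_mult_distrib mult_ac)
  qed
  ultimately have *: "cmod (ln_Gamma z - (of_real (ln_Gamma x) + \<i> * of_real (t * Digamma x)
      - of_real (Polygamma 1 x * t\<^sup>2 / 2))) \<le> 2 / x\<^sup>2 * \<bar>t\<bar> ^ 3"
    by (simp add: f_def d norm_mult)
  define L where "L = ln_Gamma z - of_real (ln_Gamma x) - \<i> * of_real (t * Digamma x)"
  have "z \<notin> \<int>\<^sub>\<le>\<^sub>0" using assms by (auto elim!: nonpos_Ints_cases simp: z_def complex_eq_iff)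
  then have "exp L = Gamma z / of_real (Gamma x) * cis (- (t * Digamma x))"
    using assms
    by (simp add: L_def exp_diff Gamma_complex_altdef Gamma_real_pos_exp exp_of_real cis_conv_exp
        exp_minus divide_inverse mult_ac)
  then have "log_gamma_char x t = exp L" by (simp add: log_gamma_char_def z_def)
  moreover have "cmod (L + of_real (Polygamma 1 x * t\<^sup>2 / 2)) \<le> 2 / x\<^sup>2 * \<bar>t\<bar> ^ 3"
    using * by (simp add: L_def algebra_simps)
  ultimately show ?thesis by (rule that)
qed

text \<open>Taken \<open>M\<close> times at \<open>t = s / S\<close>, the cubic remainder is at most
  \<open>2 * |s| ^ 3 / (x * S)\<close>, because \<open>M \<le> x * S\<^sup>2\<close>. As
  \<open>x * S \<ge> sqrt M\<close>, the error is of order \<open>1 / sqrt M\<close> however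
  \<open>x\<close> varies in \<open>x \<ge> 1\<close>.\<close>

lemma log_gamma_char_power_tendsto:
  fixes x :: "nat \<Rightarrow> real" and M :: "nat \<Rightarrow> nat"
  assumes x: "\<And>l. x l \<ge> 1" and M: "filterlim M at_top sequentially"
  shows "(\<lambda>l. log_gamma_char (x l) (s / log_gamma_scale (M l) (x l)) ^ M l)
    \<longlonglongrightarrow> of_real (exp (- (s\<^sup>2 / 2)))"
proof -
  define S where "S = (\<lambda>l. log_gamma_scale (M l) (x l))"
  define t where "t = (\<lambda>l. s / S l)"
  have "\<exists>L. log_gamma_char (x l) (t l) = exp L \<and>
      cmod (L + of_real (Polygamma 1 (x l) * (t l)\<^sup>2 / 2)) \<le> 2 / (x l)\<^sup>2 * \<bar>t l\<bar> ^ 3" for l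
    using log_gamma_char_expansion[OF x] by metis
  then obtain L where L: "\<And>l. log_gamma_char (x l) (t l) = exp (L l)"
    "\<And>l. cmod (L l + of_real (Polygamma 1 (x l) * (t l)\<^sup>2 / 2)) \<le> 2 / (x l)\<^sup>2 * \<bar>t l\<bar> ^ 3"
    by metis
  have bound: "cmod (of_nat (M l) * L l + of_real (s\<^sup>2 / 2)) \<le> 2 * \<bar>s\<bar> ^ 3 * (1 / sqrt (M l))"
    if "M l \<ge> 1" for l
  proof -
    have S: "S l > 0" using log_gamma_scale_pos[of "x l" "M l"] x[of l] that by (simp add: S_def)
    have p: "Polygamma 1 (x l) \<ge> 1 / x l" using trigamma_ge_inverse[of "x l"] x[of l] by simp
    have p0: "Polygamma 1 (x l) > 0" using trigamma_pos x[of l] by simp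
    have S2: "(S l)\<^sup>2 = M l * Polygamma 1 (x l)"
      using p0 by (simp add: S_def log_gamma_scale_def)
    have MS: "M l \<le> x l * (S l)\<^sup>2"
      using mult_left_mono[OF p, of "x l * M l"] x[of l] by (simp add: S2 mult_ac)
    have "(sqrt (M l))\<^sup>2 \<le> (x l * S l)\<^sup>2"
    proof -
      have "x l * (S l)\<^sup>2 \<le> x l * (x l * (S l)\<^sup>2)"
        using x[of l] mult_right_mono[of 1 "x l" "(S l)\<^sup>2"] by (intro mult_left_mono) auto
      then show ?thesis using MS by (simp add: power2_eq_square mult_ac)
    qed
    then have xS: "sqrt (M l) \<le> x l * S l"
      by (rule power2_le_imp_le) (use x[of l] S in simp)
    have "M l * (t l)\<^sup>2 * Polygamma 1 (x l) = (t l)\<^sup>2 * (S l)\<^sup>2"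
      by (simp add: S2)
    also have "\<dots> = s\<^sup>2" using S by (simp add: t_def power_divide)
    finally have "M l * (t l)\<^sup>2 * Polygamma 1 (x l) = s\<^sup>2" .
    then have "s\<^sup>2 / 2 = real (M l) * (Polygamma 1 (x l) * (t l)\<^sup>2 / 2)"
      by (simp add: mult_ac)
    then have "complex_of_real (s\<^sup>2 / 2) = of_nat (M l) * of_real (Polygamma 1 (x l) * (t l)\<^sup>2 / 2)"
      by (simp only: of_real_mult of_real_of_nat_eq)
    then have "of_nat (M l) * L l + of_real (s\<^sup>2 / 2)
        = of_nat (M l) * (L l + of_real (Polygamma 1 (x l) * (t l)\<^sup>2 / 2))"
      by (simp only: distrib_left)
    then have "cmod (of_nat (M l) * L l + of_real (s\<^sup>2 / 2)) \<le> M l * (2 / (x l)\<^sup>2 * \<bar>t l\<bar> ^ 3)"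
      using mult_left_mono[OF L(2)[of l], of "real (M l)"] by (simp only: norm_mult norm_of_nat of_nat_0_le_iff)
    also have "\<dots> \<le> (x l * (S l)\<^sup>2) * (2 / (x l)\<^sup>2 * \<bar>t l\<bar> ^ 3)"
      using MS by (intro mult_right_mono) auto
    also have "\<dots> = 2 * \<bar>s\<bar> ^ 3 * (1 / (x l * S l))"
      using S x[of l] by (simp add: t_def abs_divide power_divide eval_nat_numeral field_simps)
    also have "\<dots> \<le> 2 * \<bar>s\<bar> ^ 3 * (1 / sqrt (M l))"
      using xS that by (intro mult_left_mono frac_le) auto
    finally show ?thesis .
  qed
  have Mr: "filterlim (\<lambda>l. real (M l)) at_top sequentially"
    by (rule filterlim_compose[OF filterlim_real_sequentially M])
  have "((\<lambda>y. 2 * \<bar>s\<bar> ^ 3 * (1 / sqrt y)) \<longlongrightarrow> 0) at_top" by real_asymp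
  from filterlim_compose[OF this Mr]
  have b0: "(\<lambda>l. 2 * \<bar>s\<bar> ^ 3 * (1 / sqrt (M l))) \<longlonglongrightarrow> 0" .
  have "(\<lambda>l. of_nat (M l) * L l + of_real (s\<^sup>2 / 2)) \<longlonglongrightarrow> 0"
  proof (rule Lim_null_comparison[OF _ b0])
    have "eventually (\<lambda>l. M l \<ge> 1) sequentially" using M by (simp add: filterlim_at_top)
    then show "\<forall>\<^sub>F l in sequentially. cmod (of_nat (M l) * L l + of_real (s\<^sup>2 / 2)) \<le> 2 * \<bar>s\<bar> ^ 3 * (1 / sqrt (M l))"
      by (rule eventually_mono) (rule bound)
  qed
  then have "(\<lambda>l. exp ((of_nat (M l) * L l + of_real (s\<^sup>2 / 2)) - of_real (s\<^sup>2 / 2))) \<longlonglongrightarrow> exp (0 - of_real (s\<^sup>2 / 2))"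
    by (intro tendsto_intros)
  moreover have "log_gamma_char (x l) (s / log_gamma_scale (M l) (x l)) ^ M l = exp (of_nat (M l) * L l)" for l
    using L(1)[of l] by (simp add: t_def S_def exp_of_nat_mult)
  moreover have "exp (0 - complex_of_real (s\<^sup>2 / 2)) = of_real (exp (- (s\<^sup>2 / 2)))"
    by (simp flip: exp_of_real)
  ultimately show ?thesis by simp
qed

text \<open>Fourier inversion for the Gaussian, read off from its known characteristic function at
  \<open>- v\<close>.\<close>

lemma std_normal_density_fourier:
  "(\<integral>s. of_real (exp (- (s\<^sup>2 / 2))) * cis (- (v * s)) \<partial>lborel) / (2 * pi) = complex_of_real (std_normal_density v)"
proof -
  have "complex_of_real (exp (- (v\<^sup>2) / 2)) = char std_normal_distribution (- v)"
    by (simp add: char_std_normal_distribution)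
  also have "\<dots> = (\<integral>s. std_normal_density s *\<^sub>R iexp (- v * s) \<partial>lborel)"
    unfolding char_def by (subst integral_density) auto
  also have "\<dots> = (\<integral>s. of_real (1 / sqrt (2 * pi)) * (of_real (exp (- (s\<^sup>2 / 2))) * cis (- (v * s))) \<partial>lborel)"
    by (intro Bochner_Integration.integral_cong refl)
      (simp add: std_normal_density_def scaleR_conv_of_real cis_conv_exp)
  finally have "(\<integral>s. of_real (exp (- (s\<^sup>2 / 2))) * cis (- (v * s)) \<partial>lborel)
      = of_real (sqrt (2 * pi) * exp (- (v\<^sup>2) / 2))"
    by (simp add: field_simps)
  then show ?thesis
    by (simp add: std_normal_density_def field_simps flip: of_real_mult of_real_divide)
qed

text \<open>Since \<open>cis\<close> has modulus one, the difference of the densities is bounded for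
  every \<open>v\<close> by the L1 distance \<open>e\<close> of their Fourier transforms, which
  tends to zero by dominated convergence.\<close>

lemma log_gamma_density_uniform_limit:
  fixes x :: "nat \<Rightarrow> real" and M :: "nat \<Rightarrow> nat"
  assumes x: "\<And>l. x l \<ge> 1" and M: "filterlim M at_top sequentially" and M2: "\<And>l. M l \<ge> 2"
  shows "uniform_limit UNIV (\<lambda>l. log_gamma_density (M l) (x l)) (\<lambda>v. of_real (std_normal_density v)) sequentially"
proof -
  define h where "h = (\<lambda>l s. log_gamma_char (x l) (s / log_gamma_scale (M l) (x l)) ^ M l)"
  define g where "g = (\<lambda>s::real. complex_of_real (exp (- (s\<^sup>2 / 2))))"
  have meas: "h l \<in> borel_measurable borel" for l
  proof -
    have *: "of_real (x l) + of_real t * \<i> \<notin> \<int>\<^sub>\<le>\<^sub>0" for t :: real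
      using x[of l] by (auto elim!: nonpos_Ints_cases simp: complex_eq_iff)
    have G: "Gamma (x l) > 0" using x[of l] by simp
    have "continuous_on UNIV (\<lambda>t. log_gamma_char (x l) t)"
      unfolding log_gamma_char_def Complex_eq_of_real using * G
      by (intro continuous_intros continuous_on_compose2[OF continuous_on_Gamma[of "- \<int>\<^sub>\<le>\<^sub>0"]]) auto
    from borel_measurable_continuous_onI[OF this] show ?thesis
      unfolding h_def by measurable
  qed
  have gi: "integrable lborel g"
  proof -
    have "integrable lborel (\<lambda>s. complex_of_real (sqrt (2 * pi) * std_normal_density s))"
      by (intro integrable_of_real integrable_mult_right integrable_normal_density) simp
    then show ?thesis by (simp add: g_def std_normal_density_def)
  qed
  have bi: "integrable lborel (\<lambda>s::real. 1 / (1 + 1 / 2 * s\<^sup>2))"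
    by (rule integrable_inverse_one_plus_square) simp
  have hle: "cmod (h l s) \<le> 1 / (1 + 1 / 2 * s\<^sup>2)" for l s
    unfolding h_def using cmod_log_gamma_char_power_le[OF _ M2] x[of l] by simp
  have hi: "integrable lborel (h l)" for l
    using hle meas by (intro Bochner_Integration.integrable_bound[OF bi]) (auto intro!: AE_I2)
  define e where "e = (\<lambda>l. \<integral>s. cmod (h l s - g s) \<partial>lborel)"
  have "e \<longlonglongrightarrow> (\<integral>s. 0 \<partial>(lborel :: real measure))"
    unfolding e_def
  proof (rule integral_dominated_convergence[where w = "\<lambda>s. 1 / (1 + 1 / 2 * s\<^sup>2) + cmod (g s)"])
    show "integrable lborel (\<lambda>s. 1 / (1 + 1 / 2 * s\<^sup>2) + cmod (g s))"
      by (intro Bochner_Integration.integrable_add bi integrable_norm gi)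
    show "AE s in lborel. (\<lambda>l. cmod (h l s - g s)) \<longlonglongrightarrow> 0"
    proof (rule AE_I2)
      fix s
      have "(\<lambda>l. h l s - g s) \<longlonglongrightarrow> g s - g s"
        unfolding h_def g_def
        by (intro tendsto_diff log_gamma_char_power_tendsto x M tendsto_const)
      then show "(\<lambda>l. cmod (h l s - g s)) \<longlonglongrightarrow> 0" by (simp add: tendsto_norm_zero_iff)
    qed
    show "AE s in lborel. norm (cmod (h l s - g s)) \<le> 1 / (1 + 1 / 2 * s\<^sup>2) + cmod (g s)" for l
    proof (rule AE_I2)
      fix s
      show "norm (cmod (h l s - g s)) \<le> 1 / (1 + 1 / 2 * s\<^sup>2) + cmod (g s)"
        using norm_triangle_ineq4[of "h l s" "g s"] hle[of l s] by simp
    qed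
  qed (use hi gi in \<open>auto intro!: borel_measurable_norm borel_measurable_diff borel_measurable_integrable\<close>)
  then have e0: "e \<longlonglongrightarrow> 0" by simp
  have le: "cmod (log_gamma_density (M l) (x l) v - of_real (std_normal_density v)) \<le> e l" for l v
  proof -
    have cm: "(\<lambda>s. cis (- (v * s))) \<in> borel_measurable lborel"
      by (auto intro!: borel_measurable_continuous_onI continuous_intros)
    have i: "integrable lborel (\<lambda>s. f s * cis (- (v * s)))" if "integrable lborel f" for f
      using cm borel_measurable_integrable[OF that]
      by (intro Bochner_Integration.integrable_bound[OF that]) (auto simp: norm_mult)
    have "(\<integral>s. (h l s - g s) * cis (- (v * s)) \<partial>lborel)
        = (\<integral>s. h l s * cis (- (v * s)) \<partial>lborel) - (\<integral>s. g s * cis (- (v * s)) \<partial>lborel)"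
      by (simp add: left_diff_distrib i[OF hi] i[OF gi])
    then have "log_gamma_density (M l) (x l) v - of_real (std_normal_density v)
        = (\<integral>s. (h l s - g s) * cis (- (v * s)) \<partial>lborel) / (2 * pi)"
      unfolding std_normal_density_fourier[symmetric] log_gamma_density_def
      by (simp add: h_def g_def diff_divide_distrib)
    moreover have "cmod (\<integral>s. (h l s - g s) * cis (- (v * s)) \<partial>lborel) \<le> e l"
      unfolding e_def using integral_norm_bound[of lborel "\<lambda>s. (h l s - g s) * cis (- (v * s))"]
      by (simp add: norm_mult)
    moreover have "e l \<ge> 0" by (simp add: e_def)
    moreover have "2 * pi \<ge> 1" using pi_gt3 by simp
    ultimately show ?thesis
      by (simp add: norm_divide norm_mult) (smt (verit) div_by_1 frac_le norm_ge_zero)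
  qed
  show ?thesis
  proof (rule uniform_limitI)
    fix \<epsilon> :: real assume "\<epsilon> > 0"
    with e0 have "eventually (\<lambda>l. e l < \<epsilon>) sequentially" by (rule order_tendstoD(2))
    then show "\<forall>\<^sub>F l in sequentially. \<forall>v\<in>UNIV.
        dist (log_gamma_density (M l) (x l) v) (of_real (std_normal_density v)) < \<epsilon>"
      by eventually_elim (use le in \<open>auto simp: dist_norm intro: le_less_trans\<close>)
  qed
qed

section \<open>Growth of the logarithm of the factorial around the dominant index\<close>

lemma ln_Gamma_plus1:
  fixes x :: real
  assumes "x > 0"
  shows "ln_Gamma (x + 1) = ln_Gamma x + ln x"
proof -
  have "x \<notin> \<int>\<^sub>\<le>\<^sub>0" using assms by (auto elim!: nonpos_Ints_cases)
  then show ?thesis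
    using assms ln_mult_pos[of x "Gamma x"] by (simp add: ln_Gamma_real_pos Gamma_plus1)
qed

lemma DERIV_ln_Gamma_iterated:
  fixes x :: real
  assumes "x > 0"
  shows "((if m = 0 then ln_Gamma else Polygamma (m - 1)) has_real_derivative Polygamma m x) (at x)"
proof -
  have "x \<notin> \<int>\<^sub>\<le>\<^sub>0" using assms by (auto elim!: nonpos_Ints_cases)
  then show ?thesis
    using assms has_field_derivative_ln_Gamma_real[of x] has_field_derivative_Polygamma[of x "m - 1" UNIV]
    by (cases m) auto
qed

text \<open>
  Both bounds come from Taylor's formula for \<open>ln \<circ> \<Gamma>\<close> on an interval of length one,
  where \<open>ln \<circ> \<Gamma>\<close> grows by the logarithm of the left end point.
\<close>

lemma ln_minus_Digamma_ge:
  fixes x :: real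
  assumes "x \<ge> 1"
  shows "1 / (4 * x) \<le> ln x - Digamma x"
proof -
  define f where "f = (\<lambda>m::nat. if m = 0 then ln_Gamma else (Polygamma (m - 1) :: real \<Rightarrow> real))"
  have "\<exists>t>x. t < x + 1 \<and> ln_Gamma (x + 1) = (\<Sum>m<2. f m x / fact m * ((x + 1) - x) ^ m)
      + f 2 t / fact 2 * ((x + 1) - x) ^ 2"
  proof (rule Taylor_up)
    show "\<forall>m t. m < 2 \<and> x \<le> t \<and> t \<le> x + 1 \<longrightarrow> (f m has_real_derivative f (Suc m) t) (at t)"
      using DERIV_ln_Gamma_iterated assms by (auto simp: f_def)
  qed (auto simp: f_def)
  then obtain t where t: "x < t" "t < x + 1" and
    "ln_Gamma (x + 1) = (\<Sum>m<2. f m x / fact m * ((x + 1) - x) ^ m) + f 2 t / fact 2 * ((x + 1) - x) ^ 2"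
    by blast
  then have "ln x = Digamma x + Polygamma 1 t / 2"
    using ln_Gamma_plus1[of x] assms by (simp add: f_def numeral_2_eq_2)
  \<comment> \<open>Here \<open>t < x + 1 \<le> 2 * x\<close>.\<close>
  moreover have "1 / (2 * x) \<le> 1 / t" using t assms by (intro frac_le) auto
  moreover have "1 / t \<le> Polygamma 1 t" using t assms by (intro trigamma_ge_inverse) auto
  ultimately show ?thesis by (simp add: field_simps)
qed

lemma Digamma_plus1_minus_ln_ge:
  fixes x :: real
  assumes "x > 0"
  shows "1 / (4 * (x + 1)) \<le> Digamma (x + 1) - ln x"
proof -
  define f where "f = (\<lambda>m::nat. if m = 0 then ln_Gamma else (Polygamma (m - 1) :: real \<Rightarrow> real))"
  have "\<exists>t>x. t < x + 1 \<and> ln_Gamma x = (\<Sum>m<2. f m (x + 1) / fact m * (x - (x + 1)) ^ m)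
      + f 2 t / fact 2 * (x - (x + 1)) ^ 2"
  proof (rule Taylor_down)
    show "\<forall>m t. m < 2 \<and> x \<le> t \<and> t \<le> x + 1 \<longrightarrow> (f m has_real_derivative f (Suc m) t) (at t)"
      using DERIV_ln_Gamma_iterated assms by (auto simp: f_def)
  qed (auto simp: f_def)
  then obtain t where t: "x < t" "t < x + 1" and
    "ln_Gamma x = (\<Sum>m<2. f m (x + 1) / fact m * (x - (x + 1)) ^ m) + f 2 t / fact 2 * (x - (x + 1)) ^ 2"
    by blast
  then have eq: "Digamma (x + 1) - ln x = Polygamma 1 t / 2"
    using ln_Gamma_plus1[of x] assms by (simp add: f_def numeral_2_eq_2)
  have "1 / (4 * (x + 1)) \<le> 1 / t / 2" using t assms by (simp add: field_simps)
  also have "\<dots> \<le> Polygamma 1 t / 2"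
    using trigamma_ge_inverse[of t] t assms by (intro divide_right_mono) auto
  finally show ?thesis by (simp only: eq)
qed

text \<open>
  \<open>ln (b!) - b \<psi>(a + 1)\<close> is minimal at \<open>b = a\<close> and increases at least linearly away from it. A
  quadratic lower bound near \<open>a\<close> would be sharper, but is too weak far from \<open>a\<close>.
\<close>

lemma ln_fact_minus_Digamma_ge:
  fixes a b :: nat
  defines "x \<equiv> real a + 1"
  shows "\<bar>real b - real a\<bar> / (4 * x) \<le> ln (fact b) - ln (fact a) - (real b - real a) * Digamma x"
proof (cases "a \<le> b")
  case True
  then show ?thesis
  proof (induction b rule: dec_induct)
    case (step b)
    \<comment> \<open>A step upwards adds \<open>ln (b + 1) - Digamma x\<close>, which is at least
      \<open>ln x - Digamma x\<close> because \<open>b \<ge> a\<close>.\<close>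
    have "1 / (4 * x) \<le> ln x - Digamma x" by (rule ln_minus_Digamma_ge) (simp add: x_def)
    moreover have "ln x \<le> ln (real (Suc b))" using step by (simp add: x_def)
    moreover have "ln (fact (Suc b)) = ln (real (Suc b)) + ln (fact b)"
      by (simp add: ln_mult del: of_nat_Suc)
    moreover have "\<bar>real (Suc b) - real a\<bar> / (4 * x) = \<bar>real b - real a\<bar> / (4 * x) + 1 / (4 * x)"
      using step by (simp add: add_divide_distrib[symmetric])
    moreover have "(real (Suc b) - real a) * Digamma x = (real b - real a) * Digamma x + Digamma x"
      by (simp add: algebra_simps)
    ultimately show ?case using step.IH by linarith
  qed simp
next
  case False
  then have "b \<le> a" by simp
  then show ?thesis
  proof (induction b rule: inc_induct)
    case (step b)
    then have "real a > 0" by simp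
    \<comment> \<open>A step downwards adds \<open>Digamma x - ln (b + 1)\<close>, which is at least
      \<open>Digamma x - ln a\<close> because \<open>b + 1 \<le> a\<close>.\<close>
    then have "1 / (4 * x) \<le> Digamma x - ln (real a)"
      unfolding x_def by (rule Digamma_plus1_minus_ln_ge)
    moreover have "ln (real (Suc b)) \<le> ln (real a)" using step by simp
    moreover have "ln (fact (Suc b)) = ln (real (Suc b)) + ln (fact b)"
      by (simp add: ln_mult del: of_nat_Suc)
    moreover have "\<bar>real b - real a\<bar> / (4 * x) = \<bar>real (Suc b) - real a\<bar> / (4 * x) + 1 / (4 * x)"
      using step by (simp add: add_divide_distrib[symmetric])
    moreover have "(real (Suc b) - real a) * Digamma x = (real b - real a) * Digamma x + Digamma x"
      by (simp add: algebra_simps)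
    ultimately show ?case using step.IH by linarith
  qed simp
qed

section \<open>Negligibility of the other terms of the kernel sum\<close>

text \<open>Distinct positive exponents select part of the geometric series without its constant
  term. The exponents in use are the distances from \<open>a\<close> on one side.\<close>

lemma sum_power_inj_le:
  fixes r :: real
  assumes "0 \<le> r" "r < 1" "finite A" "inj_on f A" "\<And>b. b \<in> A \<Longrightarrow> f b \<ge> Suc 0"
  shows "(\<Sum>b\<in>A. r ^ f b) \<le> r / (1 - r)"
proof -
  have s: "(\<lambda>d. r * r ^ d) sums (r * (1 / (1 - r)))"
    using assms by (intro sums_mult geometric_sums) auto
  have "(\<Sum>b\<in>A. r ^ f b) = (\<Sum>b\<in>A. r * r ^ (f b - 1))"
  proof (rule sum.cong[OF refl])
    fix b assume "b \<in> A"
    then show "r ^ f b = r * r ^ (f b - 1)" using assms(5)[of b] by (cases "f b") auto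
  qed
  also have "\<dots> = (\<Sum>d\<in>(\<lambda>b. f b - 1) ` A. r * r ^ d)"
  proof (rule sum.reindex[symmetric, unfolded o_def])
    show "inj_on (\<lambda>b. f b - 1) A"
    proof (rule inj_onI)
      fix b b' assume "b \<in> A" "b' \<in> A" "f b - 1 = f b' - 1"
      then have "f b = f b'" using assms(5)[of b] assms(5)[of b'] by linarith
      then show "b = b'" using \<open>b \<in> A\<close> \<open>b' \<in> A\<close> assms(4) by (simp add: inj_on_def)
    qed
  qed
  also have "\<dots> \<le> (\<Sum>d. r * r ^ d)"
    using assms by (intro sum_le_suminf sums_summable[OF s]) auto
  also have "\<dots> = r / (1 - r)" using sums_unique[OF s] by simp
  finally show ?thesis .
qed

text \<open>
  The kernel sum relative to its term \<open>b = a\<close>, at a point whose squared modulus has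
  logarithm \<open>M \<psi>(a + 1) + w S\<close>, where \<open>S\<close> is \<open>log_gamma_scale M (a + 1)\<close>.
\<close>

definition relative_sum :: "nat \<Rightarrow> nat \<Rightarrow> nat \<Rightarrow> real \<Rightarrow> real \<Rightarrow> complex" where
  "relative_sum M N a w \<phi> = (\<Sum>b<N. cis ((real b - real a) * \<phi>) *
     of_real (exp ((real b - real a) * (M * Digamma (real a + 1) + w * log_gamma_scale M (real a + 1)))
              * (fact a / fact b) ^ M))"

text \<open>Per unit of distance from \<open>a\<close>, the factorials contribute a decay of at
  least \<open>T\<^sup>2 / 4\<close> to the exponent, and \<open>w * S\<close> a growth of at most
  \<open>sqrt 2 * B * T\<close>. So \<open>r ^ |b - a|\<close> dominates the term \<open>b\<close>,
  and the two sides of \<open>a\<close> give two geometric tails.\<close>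

lemma relative_sum_bound:
  fixes M N a :: nat and B w :: real
  defines "T \<equiv> sqrt (M / (real a + 1))"
  defines "r \<equiv> exp (- (T * (T / 4 - sqrt 2 * B)))"
  assumes "a < N" "\<bar>w\<bar> \<le> B" "r < 1"
  shows "cmod (relative_sum M N a w \<phi> - 1) \<le> 2 * (r / (1 - r))"
proof -
  define x where "x = real a + 1"
  have x: "x \<ge> 1" by (simp add: x_def)
  define S where "S = log_gamma_scale M x"
  define h where "h = (\<lambda>b. cis ((real b - real a) * \<phi>) *
     of_real (exp ((real b - real a) * (M * Digamma x + w * S)) * (fact a / fact b) ^ M))"
  have T2: "T\<^sup>2 = M / x" using x by (simp add: T_def x_def)
  have S: "S \<le> sqrt 2 * T" "S \<ge> 0"
  proof -
    have "M * Polygamma 1 x \<le> M * (2 / x)"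
      using trigamma_le[OF x] by (intro mult_left_mono) auto
    then have "S \<le> sqrt (2 * (M / x))" by (simp add: S_def log_gamma_scale_def mult.commute)
    then show "S \<le> sqrt 2 * T" by (simp only: T_def x_def real_sqrt_mult)
    show "S \<ge> 0" using trigamma_pos[of x] x by (simp add: S_def log_gamma_scale_def)
  qed
  have hle: "cmod (h b) \<le> exp (\<bar>real b - real a\<bar> * - (T * (T / 4 - sqrt 2 * B)))" for b
  proof -
    define d where "d = real b - real a"
    have f: "(fact a / fact b :: real) ^ M = exp (M * (ln (fact a) - ln (fact b)))"
      by (simp add: exp_of_nat_mult exp_diff)
    have "cmod (h b) = exp (d * (M * Digamma x + w * S) + M * (ln (fact a) - ln (fact b)))"
      unfolding h_def f by (simp add: norm_mult exp_add d_def)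
    also have "\<dots> = exp (d * (w * S) - M * (ln (fact b) - ln (fact a) - d * Digamma x))"
      by (simp add: algebra_simps)
    also have "\<dots> \<le> exp (\<bar>d\<bar> * (B * (sqrt 2 * T)) - M * (\<bar>d\<bar> / (4 * x)))"
    proof -
      have "d * (w * S) \<le> \<bar>d * (w * S)\<bar>" by simp
      also have "\<dots> = \<bar>d\<bar> * (\<bar>w\<bar> * S)" using S(2) by (simp add: abs_mult)
      also have "\<dots> \<le> \<bar>d\<bar> * (B * (sqrt 2 * T))"
        using S assms by (intro mult_left_mono mult_mono) auto
      finally have "d * (w * S) \<le> \<bar>d\<bar> * (B * (sqrt 2 * T))" .
      moreover have "M * (\<bar>d\<bar> / (4 * x)) \<le> M * (ln (fact b) - ln (fact a) - d * Digamma x)"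
        using ln_fact_minus_Digamma_ge[of b a] by (intro mult_left_mono) (simp_all add: d_def x_def)
      ultimately show ?thesis by simp
    qed
    also have "\<bar>d\<bar> * (B * (sqrt 2 * T)) - M * (\<bar>d\<bar> / (4 * x)) = \<bar>d\<bar> * (B * (sqrt 2 * T)) - \<bar>d\<bar> * (T\<^sup>2 / 4)"
      unfolding T2 using x by (simp add: field_simps)
    also have "\<dots> = \<bar>d\<bar> * - (T * (T / 4 - sqrt 2 * B))"
      by (simp add: algebra_simps power2_eq_square)
    finally show ?thesis by (simp add: d_def)
  qed
  have r: "0 \<le> r" by (simp add: r_def)
  have "relative_sum M N a w \<phi> = (\<Sum>b<N. h b)"
    by (simp add: relative_sum_def h_def x_def S_def)
  also have "\<dots> = h a + (\<Sum>b\<in>{..<N} - {a}. h b)"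
    using assms by (intro sum.remove) auto
  also have "{..<N} - {a} = {..<a} \<union> {a<..<N}" using assms by auto
  also have "(\<Sum>b\<in>\<dots>. h b) = (\<Sum>b<a. h b) + (\<Sum>b\<in>{a<..<N}. h b)"
    by (intro sum.union_disjoint) auto
  also have "h a = 1" by (simp add: h_def)
  finally have "relative_sum M N a w \<phi> - 1 = (\<Sum>b<a. h b) + (\<Sum>b\<in>{a<..<N}. h b)" by simp
  then have "cmod (relative_sum M N a w \<phi> - 1) \<le> cmod (\<Sum>b<a. h b) + cmod (\<Sum>b\<in>{a<..<N}. h b)"
    by (simp only: norm_triangle_ineq)
  also have "\<dots> \<le> (\<Sum>b<a. cmod (h b)) + (\<Sum>b\<in>{a<..<N}. cmod (h b))"
    by (intro add_mono norm_sum)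
  also have "\<dots> \<le> (\<Sum>b<a. r ^ (a - b)) + (\<Sum>b\<in>{a<..<N}. r ^ (b - a))"
  proof (intro add_mono sum_mono)
    fix b assume "b \<in> {..<a}"
    then show "cmod (h b) \<le> r ^ (a - b)"
      using hle[of b] by (simp add: r_def of_nat_diff flip: exp_of_nat_mult)
  next
    fix b assume "b \<in> {a<..<N}"
    then show "cmod (h b) \<le> r ^ (b - a)"
      using hle[of b] by (simp add: r_def of_nat_diff flip: exp_of_nat_mult)
  qed
  also have "\<dots> \<le> r / (1 - r) + r / (1 - r)"
    using r assms by (intro add_mono sum_power_inj_le) (auto simp: inj_on_def)
  finally show ?thesis by simp
qed

text \<open>A positive factor preserves the half-plane that defines the principal branch.\<close>

lemma csqrt_mult_of_real:
  assumes "r > 0"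
  shows "csqrt (of_real r * z) = of_real (sqrt r) * csqrt z"
proof (cases "z = 0")
  case False
  show ?thesis
  proof (rule csqrt_unique)
    show "(of_real (sqrt r) * csqrt z)\<^sup>2 = of_real r * z"
      using assms by (simp add: power_mult_distrib flip: of_real_power)
    show "0 < Re (of_real (sqrt r) * csqrt z) \<or>
      Re (of_real (sqrt r) * csqrt z) = 0 \<and> 0 \<le> Im (of_real (sqrt r) * csqrt z)"
      using csqrt_principal[of z] assms by auto
  qed
qed simp

section \<open>The kernel at the scaled points\<close>

text \<open>Up to a factor \<open>1 / 2\<close>, the rescaling, the two moduli and the prefactor of
  the weights multiply to the reciprocal modulus of the term \<open>b = a\<close>, so the kernel sum
  becomes \<open>relative_sum\<close>. Both densities, which are complex integrals, stay under one
  \<open>csqrt\<close>; splitting it would raise a question of branches.\<close>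

lemma scaled_kernel_entry:
  fixes M N k :: nat and c \<theta> v1 v2 \<phi>1 \<phi>2 :: real
  defines "a \<equiv> N - k" and "x \<equiv> real (N - k + 1)"
  defines "z1 \<equiv> scaled_point M N k \<theta> v1 \<phi>1" and "z2 \<equiv> scaled_point M N k \<theta> v2 \<phi>2"
  assumes "k \<in> {1..N}" "M \<ge> 2" "c > 0"
  shows "of_real (sqrt M / (rho N k * sqrt N) * cmod z1 * cmod z2) * ginibre_kernel c M N z1 z2
    = cis (a * (\<phi>1 - \<phi>2)) * (csqrt (log_gamma_density M x v1 * log_gamma_density M x v2) / (2 * pi)
        * relative_sum M N a ((v1 + v2) / 2) (\<phi>1 - \<phi>2))"
proof -
  define S where "S = log_gamma_scale M x"
  define p where "p = Polygamma 1 x"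
  have x: "x = real a + 1" "x > 0" by (simp_all add: x_def a_def)
  have p: "p > 0" using trigamma_pos[OF x(2)] by (simp add: p_def)
  have S: "S > 0" using log_gamma_scale_pos[OF x(2)] assms by (simp add: S_def)
  have N: "N \<ge> 1" using assms by auto
  define u where "u = (\<lambda>v. M * Digamma x + v * S)"
  have rho: "rho N k = 2 / (sqrt N * sqrt p)"
    by (simp add: rho_def p_def x_def real_sqrt_mult)
  have SM: "S = sqrt M * sqrt p" by (simp add: S_def log_gamma_scale_def p_def real_sqrt_mult)
  have scale: "sqrt M / (rho N k * sqrt N) = S / 2"
    using N p by (simp add: rho SM)
  \<comment> \<open>The definition of \<open>rho\<close> turns the shift by \<open>v\<close> into
    \<open>v * S / 2\<close>, so \<open>u v\<close> is the logarithm of the squared modulus.\<close>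
  have ex: "real M * (Digamma x / 2 + v / (rho N k * sqrt (real M * real N))) = u v / 2" for v
  proof -
    have "real M * (v / (rho N k * sqrt (real M * real N))) = v * sqrt p * (real M / sqrt M) / 2"
      using N p by (simp add: rho real_sqrt_mult mult_ac)
    also have "real M / sqrt M = sqrt M" by (rule real_div_sqrt) simp
    finally show ?thesis by (simp add: u_def SM algebra_simps)
  qed
  have z: "scaled_point M N k \<theta> v \<phi> = of_real (exp (u v / 2)) * cis (\<theta> + \<phi>)" for v \<phi>
    unfolding scaled_point_def x_def[symmetric] ex by (simp add: cis_conv_exp)
  have cz: "cmod (scaled_point M N k \<theta> v \<phi>) = exp (u v / 2)" for v \<phi>
    by (simp add: z norm_mult)
  define C where "C = (\<lambda>v. Gamma x ^ M * exp (- (x * u v)) / S)"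
  have G: "Gamma x = fact a" using Gamma_fact[of a] by (simp add: x add.commute)
  have C: "C v > 0" for v using S by (simp add: C_def G)
  have w: "ginibre_weight c M (scaled_point M N k \<theta> v \<phi>) = of_real (C v) * log_gamma_density M x v" for v \<phi>
    unfolding C_def S_def
    by (rule ginibre_weight_eq_density[OF cz assms(7) x(2) assms(6)]) (simp add: u_def S_def)
  define q where "q = log_gamma_density M x v1 * log_gamma_density M x v2"
  \<comment> \<open>As \<open>u\<close> is affine, the geometric mean of the squared moduli belongs
    to the midpoint of \<open>v1\<close> and \<open>v2\<close>.\<close>
  define U where "U = u ((v1 + v2) / 2)"
  have U: "U = (u v1 + u v2) / 2" by (simp add: U_def u_def field_simps)
  have "C v1 * C v2 = (fact a ^ M * exp (- (x * U)) / S)\<^sup>2"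
    by (simp add: C_def G U power2_eq_square algebra_simps add_divide_distrib flip: exp_add)
  then have sC: "sqrt (C v1 * C v2) = fact a ^ M * exp (- (x * U)) / S"
    using S by simp
  have w12: "csqrt (ginibre_weight c M z1 * ginibre_weight c M z2)
      = of_real (fact a ^ M * exp (- (x * U)) / S) * csqrt q"
  proof -
    have "ginibre_weight c M z1 * ginibre_weight c M z2 = of_real (C v1 * C v2) * q"
      by (simp add: z1_def z2_def w q_def)
    then show ?thesis using C by (simp add: csqrt_mult_of_real sC del: of_real_mult)
  qed
  have zz: "z1 * cnj z2 = of_real (exp U) * cis (\<phi>1 - \<phi>2)"
  proof -
    have "z1 * cnj z2 = of_real (exp (u v1 / 2) * exp (u v2 / 2)) * (cis (\<theta> + \<phi>1) * cis (- (\<theta> + \<phi>2)))"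
      by (simp add: z1_def z2_def z cis_cnj)
    also have "\<dots> = of_real (exp U) * cis (\<phi>1 - \<phi>2)"
      unfolding cis_mult by (simp add: U add_divide_distrib flip: exp_add)
    finally show ?thesis .
  qed
  have summand: "of_real (exp (- (real a * U)) * fact a ^ M) * ((z1 * cnj z2) ^ b / Gamma (of_nat b + 1) ^ M)
      = cis (real a * (\<phi>1 - \<phi>2)) * (cis ((real b - real a) * (\<phi>1 - \<phi>2)) *
          of_real (exp ((real b - real a) * U) * (fact a / fact b) ^ M))" for b
  proof -
    have "cis (\<phi>1 - \<phi>2) ^ b = cis (real a * (\<phi>1 - \<phi>2)) * cis ((real b - real a) * (\<phi>1 - \<phi>2))"
      unfolding Complex.DeMoivre cis_mult by (simp add: algebra_simps)
    moreover have "exp ((real b - real a) * U) = exp (- (real a * U)) * exp U ^ b"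
      by (simp add: algebra_simps flip: exp_add exp_of_nat_mult)
    moreover have "Gamma (of_nat b + 1 :: complex) = fact b"
      using Gamma_fact[of b, where 'a = complex] by (simp add: add.commute)
    ultimately show ?thesis
      by (simp add: zz power_mult_distrib power_divide)
  qed
  define Z where "Z = (\<Sum>b<N. (z1 * cnj z2) ^ b / Gamma (of_nat b + 1) ^ M)"
  have Z: "of_real (exp (- (real a * U)) * fact a ^ M) * Z
      = cis (real a * (\<phi>1 - \<phi>2)) * relative_sum M N a ((v1 + v2) / 2) (\<phi>1 - \<phi>2)"
  proof -
    have "relative_sum M N a ((v1 + v2) / 2) (\<phi>1 - \<phi>2) = (\<Sum>b<N. cis ((real b - real a) * (\<phi>1 - \<phi>2)) *
        of_real (exp ((real b - real a) * U) * (fact a / fact b) ^ M))"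
      by (simp only: relative_sum_def U_def u_def x(1) S_def)
    then show ?thesis
      unfolding Z_def by (simp only: sum_distrib_left summand)
  qed
  have cc: "cmod z1 * cmod z2 = exp U"
    by (simp add: z1_def z2_def cz U add_divide_distrib flip: exp_add)
  \<comment> \<open>The moduli of the two points lower the exponent from \<open>x = a + 1\<close> to
    \<open>a\<close>, matching the dominant term.\<close>
  have xU: "exp U * exp (- (x * U)) = exp (- (real a * U))"
    by (simp add: x algebra_simps flip: exp_add)
  define e where "e = exp (- (x * U))"
  have "of_real (sqrt M / (rho N k * sqrt N) * cmod z1 * cmod z2) * ginibre_kernel c M N z1 z2
    = of_real (S / 2 * exp U) * (1 / pi * (of_real (fact a ^ M * exp (- (x * U)) / S) * csqrt q) * Z)"
    unfolding ginibre_kernel_def w12 Z_def[symmetric] scale mult.assoc cc ..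
  also have "\<dots> = csqrt q / (2 * pi) * (of_real (exp (- (real a * U)) * fact a ^ M) * Z)"
    unfolding xU[symmetric] e_def[symmetric] using S by (simp add: field_simps)
  finally show ?thesis unfolding Z by (simp add: q_def mult_ac)
qed

section \<open>Determinants and square roots under uniform limits\<close>

lemma uniform_limit_sum:
  fixes f :: "'i \<Rightarrow> 'l \<Rightarrow> 'b \<Rightarrow> 'c::real_normed_vector"
  assumes "\<And>i. i \<in> I \<Longrightarrow> uniform_limit X (f i) (g i) F"
  shows "uniform_limit X (\<lambda>l y. \<Sum>i\<in>I. f i l y) (\<lambda>y. \<Sum>i\<in>I. g i y) F"
  using assms
  by (induction I rule: infinite_finite_induct) (auto intro!: uniform_limit_const uniform_limit_add)

text \<open>Boundedness of the limit belongs to the claim because \<open>uniform_lim_mult\<close>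
  asks for it at each step of the induction.\<close>

lemma uniform_limit_prod:
  fixes f :: "'i \<Rightarrow> 'l \<Rightarrow> 'b \<Rightarrow> complex"
  assumes "\<And>i. i \<in> I \<Longrightarrow> uniform_limit X (f i) (g i) F"
    and "\<And>i. i \<in> I \<Longrightarrow> bounded (g i ` X)"
  shows "uniform_limit X (\<lambda>l y. \<Prod>i\<in>I. f i l y) (\<lambda>y. \<Prod>i\<in>I. g i y) F \<and>
         bounded ((\<lambda>y. \<Prod>i\<in>I. g i y) ` X)"
  using assms
proof (induction I rule: infinite_finite_induct)
  case (insert a I)
  obtain A where A: "\<And>y. y \<in> X \<Longrightarrow> cmod (g a y) \<le> A"
    using insert(5)[of a] unfolding bounded_iff by auto
  have "bounded ((\<lambda>y. \<Prod>i\<in>I. g i y) ` X)" using insert by auto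
  then obtain B where B: "\<And>y. y \<in> X \<Longrightarrow> cmod (\<Prod>i\<in>I. g i y) \<le> B"
    unfolding bounded_iff by auto
  have "cmod (g a y * (\<Prod>i\<in>I. g i y)) \<le> A * B" if "y \<in> X" for y
    using A[OF that] B[OF that] unfolding norm_mult
    by (intro mult_mono) (auto intro: order_trans[OF norm_ge_zero])
  then have "bounded ((\<lambda>y. g a y * (\<Prod>i\<in>I. g i y)) ` X)"
    unfolding bounded_iff by blast
  moreover have "uniform_limit X (\<lambda>l y. f a l y * (\<Prod>i\<in>I. f i l y)) (\<lambda>y. g a y * (\<Prod>i\<in>I. g i y)) F"
    using insert by (intro uniform_lim_mult) auto
  ultimately show ?case using insert(1,2) by simp
qed (auto intro: uniform_limit_const simp: bounded_iff)

lemma det_mat_Leibniz: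
  "Determinant.det (Matrix.mat n n (\<lambda>(i, j). h i j))
    = (\<Sum>p | p permutes {0..<n}. signof p * (\<Prod>i = 0..<n. h i (p i)))"
  unfolding det_def'[OF mat_carrier]
proof (rule sum.cong[OF refl])
  fix p assume p: "p \<in> {p. p permutes {0..<n}}"
  have "(\<Prod>i = 0..<n. Matrix.mat n n (\<lambda>(i, j). h i j) $$ (i, p i)) = (\<Prod>i = 0..<n. h i (p i))"
  proof (rule prod.cong[OF refl])
    fix i assume "i \<in> {0..<n}"
    then show "Matrix.mat n n (\<lambda>(i, j). h i j) $$ (i, p i) = h i (p i)"
      using p permutes_in_image[of p "{0..<n}" i] by simp
  qed
  then show "signof p * (\<Prod>i = 0..<n. Matrix.mat n n (\<lambda>(i, j). h i j) $$ (i, p i))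
      = signof p * (\<Prod>i = 0..<n. h i (p i))"
    by (rule arg_cong)
qed

lemma uniform_limit_det:
  fixes f :: "nat \<Rightarrow> nat \<Rightarrow> 'l \<Rightarrow> 'b \<Rightarrow> complex"
  assumes "\<And>i j. i < n \<Longrightarrow> j < n \<Longrightarrow> uniform_limit X (f i j) (g i j) F"
    and "\<And>i j. i < n \<Longrightarrow> j < n \<Longrightarrow> bounded (g i j ` X)"
  shows "uniform_limit X (\<lambda>l y. Determinant.det (Matrix.mat n n (\<lambda>(i, j). f i j l y)))
           (\<lambda>y. Determinant.det (Matrix.mat n n (\<lambda>(i, j). g i j y))) F"
  unfolding det_mat_Leibniz
proof (intro uniform_limit_sum bounded_linear.uniform_limit[OF bounded_linear_mult_right])
    fix p assume "p \<in> {p. p permutes {0..<n}}"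
    then have "p i < n" if "i < n" for i using that permutes_in_image[of p "{0..<n}" i] by auto
    then show "uniform_limit X (\<lambda>l y. \<Prod>i = 0..<n. f i (p i) l y) (\<lambda>y. \<Prod>i = 0..<n. g i (p i) y) F"
      using assms by (intro conjunct1[OF uniform_limit_prod]) auto
qed

text \<open>Every Leibniz term meets each row and each column exactly once. This serves both to
  distribute the moduli over the entries and to remove the phases.\<close>

lemma det_diagonal_scaling:
  fixes K :: "nat \<Rightarrow> nat \<Rightarrow> complex"
  shows "Determinant.det (Matrix.mat n n (\<lambda>(i, j). d i * e j * K i j))
    = (\<Prod>i<n. d i) * (\<Prod>i<n. e i) * Determinant.det (Matrix.mat n n (\<lambda>(i, j). K i j))"
  unfolding det_mat_Leibniz sum_distrib_left
proof (rule sum.cong[OF refl])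
    fix p assume "p \<in> {p. p permutes {0..<n}}"
    then have "(\<Prod>i = 0..<n. e (p i)) = (\<Prod>i = 0..<n. e i)"
      using prod.permute[of p "{0..<n}" e] by (simp add: o_def)
    then show "signof p * (\<Prod>i = 0..<n. d i * e (p i) * K i (p i))
        = (\<Prod>i<n. d i) * (\<Prod>i<n. e i) * (signof p * (\<Prod>i = 0..<n. K i (p i)))"
      by (simp add: prod.distrib atLeast0LessThan mult_ac)
qed

text \<open>Extracting \<open>g\<close> from rows and columns leaves the matrix of ones, which has
  two equal rows as soon as \<open>n > 1\<close>.\<close>

lemma det_rank_one:
  fixes g :: "nat \<Rightarrow> complex"
  assumes "n \<ge> 1"
  shows "Determinant.det (Matrix.mat n n (\<lambda>(i, j). g i * g j)) = (if n = 1 then (g 0)\<^sup>2 else 0)"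
proof (cases "n = 1")
  case True
  have "Matrix.mat 1 1 (\<lambda>(i, j). 1) = (1\<^sub>m 1 :: complex mat)" by (intro eq_matI) auto
  then show ?thesis
    using det_diagonal_scaling[of n g g "\<lambda>i j. 1"] True
    by (simp add: power2_eq_square det_one)
next
  case False
  have "Determinant.det (Matrix.mat n n (\<lambda>(i, j). 1 :: complex)) = 0"
  proof (rule det_identical_rows)
    show "(0::nat) \<noteq> 1" "0 < n" "1 < n" using False assms by auto
    then show "Matrix.row (Matrix.mat n n (\<lambda>(i, j). 1 :: complex)) 0 = Matrix.row (Matrix.mat n n (\<lambda>(i, j). 1)) 1"
      by (intro eq_vecI) auto
  qed simp
  then show ?thesis
    using det_diagonal_scaling[of n g g "\<lambda>i j. 1"] False by simp
qed

text \<open>The difference of the roots times their sum is \<open>w - p\<close>, and the sum has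
  modulus at least \<open>sqrt \<delta>\<close> because \<open>csqrt\<close> has nonnegative real
  part. The branch cut therefore does no harm, whatever the argument of \<open>w\<close>.\<close>

lemma uniform_limit_csqrt:
  fixes w :: "'l \<Rightarrow> 'b \<Rightarrow> complex" and p :: "'b \<Rightarrow> real"
  assumes "uniform_limit X w (\<lambda>y. of_real (p y)) F"
    and "\<delta> > 0" "\<And>y. y \<in> X \<Longrightarrow> p y \<ge> \<delta>"
  shows "uniform_limit X (\<lambda>l y. csqrt (w l y)) (\<lambda>y. of_real (sqrt (p y))) F"
proof (rule uniform_limitI)
  fix \<epsilon> :: real assume "\<epsilon> > 0"
  then have "\<forall>\<^sub>F l in F. \<forall>y\<in>X. dist (w l y) (of_real (p y)) < \<epsilon> * sqrt \<delta>"
    using assms by (intro uniform_limitD) auto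
  then show "\<forall>\<^sub>F l in F. \<forall>y\<in>X. dist (csqrt (w l y)) (of_real (sqrt (p y))) < \<epsilon>"
  proof (rule eventually_mono, intro ballI)
    fix l y assume *: "\<forall>y\<in>X. dist (w l y) (of_real (p y)) < \<epsilon> * sqrt \<delta>" and y: "y \<in> X"
    define s where "s = sqrt (p y)"
    have s: "s \<ge> sqrt \<delta>" using assms(3)[OF y] by (simp add: s_def)
    have "Re (csqrt (w l y)) \<ge> 0" using csqrt_principal[of "w l y"] by auto
    moreover have "Re (csqrt (w l y) + of_real s) = Re (csqrt (w l y)) + s"
      by (simp only: plus_complex.sel Re_complex_of_real)
    ultimately have "sqrt \<delta> \<le> Re (csqrt (w l y) + of_real s)" using s by linarith
    also have "\<dots> \<le> cmod (csqrt (w l y) + of_real s)" by (rule complex_Re_le_cmod)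
    finally have "cmod (csqrt (w l y) - of_real s) * sqrt \<delta>
        \<le> cmod (csqrt (w l y) - of_real s) * cmod (csqrt (w l y) + of_real s)"
      by (rule mult_left_mono) simp
    also have "\<dots> = cmod ((csqrt (w l y))\<^sup>2 - (of_real s)\<^sup>2)"
      by (simp add: norm_mult[symmetric] power2_eq_square algebra_simps)
    also have "\<dots> = dist (w l y) (of_real (p y))"
    proof -
      have "s\<^sup>2 = p y" using assms(2,3) y by (force simp: s_def)
      then show ?thesis by (simp add: dist_norm flip: of_real_power)
    qed
    also have "\<dots> < \<epsilon> * sqrt \<delta>" using * y by blast
    finally show "dist (csqrt (w l y)) (of_real (sqrt (p y))) < \<epsilon>"
      using assms(2) by (simp add: dist_norm s_def)
  qed
qed

text \<open>From \<open>a + 1 \<le> N\<close> follows \<open>T \<ge> sqrt (M / N)\<close>, so the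
  ratio \<open>r\<close> tends to zero for any choice of \<open>a\<close>. The angles enter only
  through factors of modulus one, so the bound is uniform in them.\<close>

lemma uniform_limit_relative_sum:
  fixes M N a :: "nat \<Rightarrow> nat" and w \<phi> :: "'b \<Rightarrow> real"
  assumes a: "\<And>l. a l < N l"
    and lim: "filterlim (\<lambda>l. real (M l) / real (N l)) at_top sequentially"
    and w: "\<And>y. y \<in> X \<Longrightarrow> \<bar>w y\<bar> \<le> B"
  shows "uniform_limit X (\<lambda>l y. relative_sum (M l) (N l) (a l) (w y) (\<phi> y)) (\<lambda>y. 1) sequentially"
proof -
  define T where "T = (\<lambda>l. sqrt (M l / (real (a l) + 1)))"
  define r where "r = (\<lambda>l. exp (- (T l * (T l / 4 - sqrt 2 * B))))"
  have lim': "filterlim (\<lambda>l. sqrt (real (M l) / real (N l))) at_top sequentially"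
    by (rule filterlim_compose[OF sqrt_at_top lim])
  have le: "sqrt (real (M l) / real (N l)) \<le> T l" for l
  proof -
    have "real (a l) + 1 \<le> real (N l)" using a[of l] by linarith
    then show ?thesis unfolding T_def by (intro real_sqrt_le_mono divide_left_mono) auto
  qed
  have T: "filterlim T at_top sequentially"
    by (rule filterlim_at_top_mono[OF lim']) (simp add: le)
  have "((\<lambda>t. exp (- (t * (t / 4 - sqrt 2 * B)))) \<longlongrightarrow> 0) at_top" by real_asymp
  from filterlim_compose[OF this T] have r0: "r \<longlonglongrightarrow> 0" by (simp add: r_def)
  then have "(\<lambda>l. 2 * (r l / (1 - r l))) \<longlonglongrightarrow> 2 * (0 / (1 - 0))"
    by (intro tendsto_intros) auto
  then have e0: "(\<lambda>l. 2 * (r l / (1 - r l))) \<longlonglongrightarrow> 0" by simp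
  show ?thesis
  proof (rule uniform_limitI)
    fix \<epsilon> :: real assume "\<epsilon> > 0"
    with e0 have "\<forall>\<^sub>F l in sequentially. 2 * (r l / (1 - r l)) < \<epsilon>" by (rule order_tendstoD)
    moreover have "\<forall>\<^sub>F l in sequentially. r l < 1" using r0 by (rule order_tendstoD) simp
    ultimately show "\<forall>\<^sub>F l in sequentially. \<forall>y\<in>X.
        dist (relative_sum (M l) (N l) (a l) (w y) (\<phi> y)) 1 < \<epsilon>"
    proof eventually_elim
      case (elim l)
      show ?case
      proof
        fix y assume "y \<in> X"
        then have "cmod (relative_sum (M l) (N l) (a l) (w y) (\<phi> y) - 1) \<le> 2 * (r l / (1 - r l))"
          using elim relative_sum_bound[OF a w] by (simp add: r_def T_def)
        then show "dist (relative_sum (M l) (N l) (a l) (w y) (\<phi> y)) 1 < \<epsilon>"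
          using elim by (simp add: dist_norm)
      qed
    qed
  qed
qed

section \<open>The limit of the scaled correlation functions\<close>

lemma std_normal_density_ge:
  assumes "\<bar>v\<bar> \<le> B"
  shows "std_normal_density B \<le> std_normal_density v"
proof -
  have "v\<^sup>2 \<le> B\<^sup>2" using assms by (simp add: abs_le_square_iff[symmetric])
  then show ?thesis by (simp add: std_normal_density_def divide_right_mono)
qed

lemma std_normal_density_le: "std_normal_density v \<le> 1"
proof -
  have "1 \<le> sqrt (2 * pi)" using pi_gt3 by simp
  then have "exp (- v\<^sup>2 / 2) / sqrt (2 * pi) \<le> 1 / 1"
    by (intro frac_le) auto
  then show ?thesis by (simp add: std_normal_density_def)
qed

text \<open>
  The common phases \<open>exp (\<i> a (\<phi>\<^sub>i - \<phi>\<^sub>j))\<close> of the entries are conjugation by a unitary diagonal matrix, so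
  they do not change the determinant.
\<close>

lemma scaled_correlation_eq_det:
  fixes M N k n :: nat and c \<theta> :: real and v \<phi> :: "nat \<Rightarrow> real"
  defines "z \<equiv> (\<lambda>j\<in>{..<n}. scaled_point M N k \<theta> (v j) (\<phi> j))"
  assumes "k \<in> {1..N}" "M \<ge> 2" "c > 0"
  shows "of_real ((sqrt M / (rho N k * sqrt N)) ^ n * (cmod (\<Prod>j<n. z j))\<^sup>2)
      * Determinant.det (Matrix.mat n n (\<lambda>(i, j). ginibre_kernel c M N (z i) (z j)))
    = Determinant.det (Matrix.mat n n (\<lambda>(i, j).
        csqrt (log_gamma_density M (real (N - k + 1)) (v i) * log_gamma_density M (real (N - k + 1)) (v j)) / (2 * pi)
          * relative_sum M N (N - k) ((v i + v j) / 2) (\<phi> i - \<phi> j)))"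
    (is "?L = Determinant.det (Matrix.mat n n (\<lambda>(i, j). ?F i j))")
proof -
  define s where "s = sqrt M / (rho N k * sqrt N)"
  define a where "a = real (N - k)"
  have "?L = (\<Prod>i<n. of_real (s * cmod (z i))) * (\<Prod>j<n. of_real (cmod (z j)))
      * Determinant.det (Matrix.mat n n (\<lambda>(i, j). ginibre_kernel c M N (z i) (z j)))"
    by (simp add: prod.distrib s_def[symmetric] power2_eq_square prod_norm[symmetric] mult_ac)
  also have "\<dots> = Determinant.det (Matrix.mat n n (\<lambda>(i, j).
      of_real (s * cmod (z i)) * of_real (cmod (z j)) * ginibre_kernel c M N (z i) (z j)))"
    by (rule det_diagonal_scaling[symmetric])
  also have "Matrix.mat n n (\<lambda>(i, j).
      of_real (s * cmod (z i)) * of_real (cmod (z j)) * ginibre_kernel c M N (z i) (z j))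
    = Matrix.mat n n (\<lambda>(i, j). cis (a * \<phi> i) * cis (- (a * \<phi> j)) * ?F i j)"
  proof (rule cong_mat[OF refl refl])
    fix i j assume "i < n" "j < n"
    then show "(case (i, j) of (i, j) \<Rightarrow>
        of_real (s * cmod (z i)) * of_real (cmod (z j)) * ginibre_kernel c M N (z i) (z j))
      = (case (i, j) of (i, j) \<Rightarrow> cis (a * \<phi> i) * cis (- (a * \<phi> j)) * ?F i j)"
      using scaled_kernel_entry[OF assms(2-4), of \<theta> "v i" "\<phi> i" "v j" "\<phi> j"]
      by (simp add: z_def s_def a_def cis_mult right_diff_distrib)
  qed
  also have "Determinant.det \<dots> = (\<Prod>i<n. cis (a * \<phi> i)) * (\<Prod>j<n. cis (- (a * \<phi> j)))
      * Determinant.det (Matrix.mat n n (\<lambda>(i, j). ?F i j))"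
    by (rule det_diagonal_scaling)
  also have "(\<Prod>i<n. cis (a * \<phi> i)) * (\<Prod>j<n. cis (- (a * \<phi> j))) = 1"
    by (simp add: prod.distrib[symmetric] cis_mult)
  finally show ?thesis by simp
qed

text \<open>The entries tend to \<open>g (v i) * g (v j)\<close>, a matrix of rank one. A bound
  \<open>B\<close> for \<open>V\<close> controls the relative sums and also keeps the Gaussian
  density above \<open>\<delta>\<close>, as the limit under \<open>csqrt\<close> requires.\<close>

lemma uniform_limit_det_density:
  fixes n :: nat and M N k :: "nat \<Rightarrow> nat" and V :: "real set"
  defines "x \<equiv> \<lambda>l. real (N l - k l + 1)"
  assumes "n \<ge> 1" and M2: "\<And>l. M l \<ge> 2" and M: "filterlim M at_top sequentially"
    and lim: "filterlim (\<lambda>l. real (M l) / real (N l)) at_top sequentially"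
    and k: "\<And>l. k l \<in> {1..N l}" and "bounded V"
  shows "uniform_limit {(v, \<phi>). \<forall>j<n. v j \<in> V}
     (\<lambda>l (v, \<phi>). Determinant.det (Matrix.mat n n (\<lambda>(i, j).
        csqrt (log_gamma_density (M l) (x l) (v i) * log_gamma_density (M l) (x l) (v j)) / (2 * pi)
          * relative_sum (M l) (N l) (N l - k l) ((v i + v j) / 2) (\<phi> i - \<phi> j))))
     (\<lambda>(v, \<phi>). of_real (if n = 1 then std_normal_density (v 0) / (2 * pi) else 0)) sequentially"
proof -
  define X :: "((nat \<Rightarrow> real) \<times> (nat \<Rightarrow> real)) set" where "X = {(v, \<phi>). \<forall>j<n. v j \<in> V}"
  obtain B where B: "\<And>v. v \<in> V \<Longrightarrow> \<bar>v\<bar> \<le> B"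
    using \<open>bounded V\<close> unfolding bounded_iff by auto
  define \<delta> where "\<delta> = std_normal_density B"
  have \<delta>: "\<delta> > 0" by (simp add: \<delta>_def normal_density_pos)
  \<comment> \<open>Normalized so that \<open>(g v)\<^sup>2\<close> is the limit for
    \<open>n = 1\<close>.\<close>
  define g where "g = (\<lambda>v. complex_of_real (sqrt (std_normal_density v / (2 * pi))))"
  have lim_entry: "uniform_limit X
     (\<lambda>l y. csqrt (log_gamma_density (M l) (x l) (fst y i) * log_gamma_density (M l) (x l) (fst y j)) / (2 * pi)
          * relative_sum (M l) (N l) (N l - k l) ((fst y i + fst y j) / 2) (snd y i - snd y j))
     (\<lambda>y. g (fst y i) * g (fst y j)) sequentially" if ij: "i < n" "j < n" for i j
  proof -
    have d: "uniform_limit X (\<lambda>l y. log_gamma_density (M l) (x l) (fst y m))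
        (\<lambda>y. of_real (std_normal_density (fst y m))) sequentially" for m
      by (rule uniform_limit_compose'[OF log_gamma_density_uniform_limit[OF _ M M2]]) (auto simp: x_def)
    have b: "bounded ((\<lambda>y. complex_of_real (std_normal_density (fst y m))) ` X)" for m
      unfolding bounded_iff using std_normal_density_le by (intro exI[of _ 1]) auto
    have "uniform_limit X (\<lambda>l y. log_gamma_density (M l) (x l) (fst y i) * log_gamma_density (M l) (x l) (fst y j))
        (\<lambda>y. of_real (std_normal_density (fst y i) * std_normal_density (fst y j))) sequentially"
      using uniform_lim_mult[OF d d b b] by simp
    then have c: "uniform_limit X
        (\<lambda>l y. csqrt (log_gamma_density (M l) (x l) (fst y i) * log_gamma_density (M l) (x l) (fst y j)))
        (\<lambda>y. of_real (sqrt (std_normal_density (fst y i) * std_normal_density (fst y j)))) sequentially"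
    proof (rule uniform_limit_csqrt)
      show "\<delta> * \<delta> > 0" using \<delta> by simp
      fix y assume "y \<in> X"
      then have "\<bar>fst y i\<bar> \<le> B" "\<bar>fst y j\<bar> \<le> B" using ij B by (auto simp: X_def)
      then show "\<delta> * \<delta> \<le> std_normal_density (fst y i) * std_normal_density (fst y j)"
        unfolding \<delta>_def by (intro mult_mono std_normal_density_ge) auto
    qed
    have c': "uniform_limit X
        (\<lambda>l y. csqrt (log_gamma_density (M l) (x l) (fst y i) * log_gamma_density (M l) (x l) (fst y j)) / (2 * pi))
        (\<lambda>y. complex_of_real (sqrt (std_normal_density (fst y i) * std_normal_density (fst y j))) / (2 * pi)) sequentially"
      by (rule bounded_linear.uniform_limit[OF bounded_linear_divide c])
    have cb: "bounded ((\<lambda>y. complex_of_real (sqrt (std_normal_density (fst y i) * std_normal_density (fst y j))) / (2 * pi)) ` X)"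
      unfolding bounded_iff
    proof (intro exI ballI)
      fix w assume "w \<in> (\<lambda>y. complex_of_real (sqrt (std_normal_density (fst y i) * std_normal_density (fst y j))) / (2 * pi)) ` X"
      then obtain y where w: "w = complex_of_real (sqrt (std_normal_density (fst y i) * std_normal_density (fst y j))) / (2 * pi)"
        by auto
      have "std_normal_density (fst y i) * std_normal_density (fst y j) \<le> 1 * 1"
        by (intro mult_mono std_normal_density_le) auto
      moreover have "1 \<le> 2 * pi" using pi_gt3 by simp
      ultimately have "sqrt (std_normal_density (fst y i) * std_normal_density (fst y j)) / (2 * pi) \<le> 1 / 1"
        by (intro frac_le) auto
      then show "cmod w \<le> 1" by (simp add: w norm_divide norm_mult)
    qed
    have e: "uniform_limit X
        (\<lambda>l y. relative_sum (M l) (N l) (N l - k l) ((fst y i + fst y j) / 2) (snd y i - snd y j)) (\<lambda>y. 1) sequentially"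
    proof (rule uniform_limit_relative_sum[OF _ lim, where B = B])
      show "N l - k l < N l" for l using k[of l] by auto
      fix y assume "y \<in> X"
      then have "\<bar>fst y i\<bar> \<le> B" "\<bar>fst y j\<bar> \<le> B" using ij B by (auto simp: X_def)
      then show "\<bar>(fst y i + fst y j) / 2\<bar> \<le> B" by (simp add: abs_le_iff field_simps)
    qed
    have eb: "bounded ((\<lambda>y. 1 :: complex) ` X)" by (auto simp: bounded_iff)
    have "sqrt (p * q) / r = sqrt (p / r) * sqrt (q / r)" if "r \<ge> 0" for p q r :: real
      using that by (simp add: real_sqrt_divide real_sqrt_mult)
    from this[of "2 * pi"] have eq: "sqrt (p * q) / (2 * pi) = sqrt (p / (2 * pi)) * sqrt (q / (2 * pi))" for p q :: real
      by simp
    have "complex_of_real (sqrt (std_normal_density (fst y i) * std_normal_density (fst y j))) / (2 * pi) * 1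
        = g (fst y i) * g (fst y j)" for y :: "(nat \<Rightarrow> real) \<times> (nat \<Rightarrow> real)"
      unfolding g_def by (simp only: eq of_real_mult[symmetric] of_real_divide[symmetric] mult_1_right)
    with uniform_lim_mult[OF c' e cb eb] show ?thesis by simp
  qed
  have gb: "bounded ((\<lambda>y. g (fst y i) * g (fst y j)) ` X)" for i j
    unfolding bounded_iff
  proof (intro exI ballI)
    fix w assume "w \<in> (\<lambda>y. g (fst y i) * g (fst y j)) ` X"
    then obtain y where w: "w = g (fst y i) * g (fst y j)" by auto
    have "cmod (g v) \<le> 1" for v
    proof -
      have "1 \<le> 2 * pi" using pi_gt3 by simp
      then have "std_normal_density v / (2 * pi) \<le> 1 / 1"
        by (intro frac_le std_normal_density_le) auto
      then show ?thesis by (simp add: g_def)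
    qed
    then have "cmod (g (fst y i)) * cmod (g (fst y j)) \<le> 1 * 1" by (intro mult_mono) auto
    then show "cmod w \<le> 1" by (simp add: w norm_mult)
  qed
  have "(g v)\<^sup>2 = of_real (std_normal_density v / (2 * pi))" for v
    by (simp add: g_def flip: of_real_power)
  then have det_g: "Determinant.det (Matrix.mat n n (\<lambda>(i, j). g (fst y i) * g (fst y j)))
      = of_real (if n = 1 then std_normal_density (fst y 0) / (2 * pi) else 0)"
    for y :: "(nat \<Rightarrow> real) \<times> (nat \<Rightarrow> real)"
    using det_rank_one[OF \<open>n \<ge> 1\<close>, of "\<lambda>i. g (fst y i)"] by simp
  have "uniform_limit X (\<lambda>l y. Determinant.det (Matrix.mat n n (\<lambda>(i, j).
        csqrt (log_gamma_density (M l) (x l) (fst y i) * log_gamma_density (M l) (x l) (fst y j)) / (2 * pi)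
          * relative_sum (M l) (N l) (N l - k l) ((fst y i + fst y j) / 2) (snd y i - snd y j))))
      (\<lambda>y. Determinant.det (Matrix.mat n n (\<lambda>(i, j). g (fst y i) * g (fst y j)))) sequentially"
    by (rule uniform_limit_det[OF lim_entry gb])
  then show ?thesis
    unfolding det_g X_def by (simp only: case_prod_unfold)
qed

theorem theorem1p1:
  fixes n :: nat and c \<theta> :: real
    and M N k :: "nat \<Rightarrow> nat"
    and P :: "nat \<Rightarrow> 'w measure"
    and X :: "nat \<Rightarrow> nat \<Rightarrow> 'w \<Rightarrow> complex mat"
    and R :: "nat \<Rightarrow> (nat \<Rightarrow> complex) \<Rightarrow> real"
    and V :: "real set"
  assumes "n \<ge> 1" and "c > 0"
    and "\<And>l. M l \<ge> 1" and "\<And>l. N l \<ge> 1"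
    and "filterlim (\<lambda>l. M l + N l) at_top sequentially"
    and "filterlim (\<lambda>l. real (M l) / real (N l)) at_top sequentially"
    and "\<And>l. k l \<in> {1..N l}"
    and "\<theta> \<in> {-pi<..pi}"
    and "\<And>l. ginibre_family (P l) (M l) (N l) (X l)"
    and "\<And>l. is_correlation_function (P l)
               (\<lambda>\<omega>. eigenvalue_list (ginibre_product (N l) (X l) (M l) \<omega>)) n (R l)"
    and "\<And>l z. z \<in> {..<n} \<rightarrow>\<^sub>E UNIV \<Longrightarrow>
           complex_of_real (R l z)
             = Determinant.det (Matrix.mat n n (\<lambda>(i, j). ginibre_kernel c (M l) (N l) (z i) (z j)))"
    and "compact V"
  shows "uniform_limit
           {(v, \<phi>). \<forall>j<n. v j \<in> V \<and> \<phi> j \<in> {-pi<..pi}}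
           (\<lambda>l (v, \<phi>).
              let z = (\<lambda>j\<in>{..<n}. scaled_point (M l) (N l) (k l) \<theta> (v j) (\<phi> j))
              in (sqrt (real (M l)) / (rho (N l) (k l) * sqrt (real (N l)))) ^ n
                   * (cmod (\<Prod>j<n. z j))\<^sup>2 * R l z)
           (\<lambda>(v, \<phi>). if n = 1 then 1 / sqrt (2 * pi) ^ 3 * exp (- (1/2) * (v 0)\<^sup>2) else 0)
           sequentially"
    (is "uniform_limit ?X ?f ?g sequentially")
proof -
  have "real (M l) / real (N l) \<le> real (M l)" for l
    using assms(4)[of l] mult_left_mono[of 1 "real (N l)" "real (M l)"] by (simp add: divide_le_eq)
  then have "filterlim (\<lambda>l. real (M l)) at_top sequentially"
    by (intro filterlim_at_top_mono[OF assms(6)] always_eventually allI)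
  then have "\<forall>\<^sub>F l in sequentially. real Z \<le> real (M l)" for Z
    by (simp only: filterlim_at_top)
  then have M: "filterlim M at_top sequentially"
    by (simp add: filterlim_at_top)
  \<comment> \<open>The integrable majorant is available from \<open>M = 2\<close> on. Finitely many
    indices do not affect the limit, so the sequences are shifted by \<open>l0\<close>.\<close>
  then obtain l0 where l0: "\<And>l. l \<ge> l0 \<Longrightarrow> M l \<ge> 2"
    unfolding filterlim_at_top eventually_sequentially by blast
  define M' N' k' where "M' = (\<lambda>l. M (l + l0))" and "N' = (\<lambda>l. N (l + l0))" and "k' = (\<lambda>l. k (l + l0))"
  have shift: "filterlim (\<lambda>l. l + l0) sequentially sequentially"
    by (rule filterlim_add_const_nat_at_top)
  define D where "D = (\<lambda>l (v, \<phi>). Determinant.det (Matrix.mat n n (\<lambda>(i, j).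
        csqrt (log_gamma_density (M' l) (real (N' l - k' l + 1)) (v i)
             * log_gamma_density (M' l) (real (N' l - k' l + 1)) (v j)) / (2 * pi)
          * relative_sum (M' l) (N' l) (N' l - k' l) ((v i + v j) / 2) (\<phi> i - \<phi> j))))"
  have lim: "uniform_limit {(v, \<phi>). \<forall>j<n. v j \<in> V} D
     (\<lambda>(v, \<phi>). of_real (if n = 1 then std_normal_density (v 0) / (2 * pi) else 0)) sequentially"
    unfolding D_def
  proof (rule uniform_limit_det_density[OF assms(1)])
    show "M' l \<ge> 2" for l by (simp add: M'_def l0)
    show "filterlim M' at_top sequentially"
      unfolding M'_def by (rule filterlim_compose[OF M shift])
    show "filterlim (\<lambda>l. real (M' l) / real (N' l)) at_top sequentially"
      unfolding M'_def N'_def by (rule filterlim_compose[OF assms(6) shift])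
    show "k' l \<in> {1..N' l}" for l using assms(7) by (simp add: k'_def N'_def)
    show "bounded V" using assms(12) by (rule compact_imp_bounded)
  qed
  \<comment> \<open>The correlation function is real, while the determinant limit is complex; both
    are compared after embedding the reals, which preserves distances.\<close>
  have fD: "complex_of_real (?f (l + l0) y) = D l y" for l y
  proof -
    obtain v \<phi> where y: "y = (v, \<phi>)" by (cases y)
    define z where "z = (\<lambda>j\<in>{..<n}. scaled_point (M (l + l0)) (N (l + l0)) (k (l + l0)) \<theta> (v j) (\<phi> j))"
    have "z \<in> {..<n} \<rightarrow>\<^sub>E UNIV" by (simp add: z_def)
    note R = assms(11)[OF this, of "l + l0"]
    show ?thesis
      unfolding y D_def prod.case Let_def z_def[symmetric] of_real_mult R
      unfolding of_real_mult[symmetric] z_def M'_def N'_def k'_def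
      by (rule scaled_correlation_eq_det) (use assms l0 in auto)
  qed
  have gD: "complex_of_real (?g y) = (\<lambda>(v, \<phi>). of_real (if n = 1 then std_normal_density (v 0) / (2 * pi) else 0)) y" for y
    by (cases y) (simp add: std_normal_density_def power3_eq_cube)
  show ?thesis
  proof (rule uniform_limitI)
    fix \<epsilon> :: real assume "\<epsilon> > 0"
    with lim have "\<forall>\<^sub>F l in sequentially. \<forall>y\<in>{(v, \<phi>). \<forall>j<n. v j \<in> V}.
        dist (D l y) (of_real (?g y)) < \<epsilon>"
      unfolding gD by (rule uniform_limitD)
    then have "\<forall>\<^sub>F l in sequentially. \<forall>y\<in>?X. dist (?f (l + l0) y) (?g y) < \<epsilon>"
      by (rule eventually_mono) (auto simp: fD[symmetric] dist_of_real simp del: of_real_mult)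
    then show "\<forall>\<^sub>F l in sequentially. \<forall>y\<in>?X. dist (?f l y) (?g y) < \<epsilon>"
      \<comment> \<open>This undoes the shift by \<open>l0\<close>.\<close>
      by (subst (asm) eventually_sequentially_seg)
  qed
qed

end
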